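(* Let $(G,g)$ be a connected, simply connected three-dimensional Lie group with a left-invariant Lorentzian metric of non-unimodular Type IV.3, i.e. its Lie algebra admits a pseudo-orthonormal basis $\{e_1,e_2,e_3\}$ with $g(e_1,e_1)=-g(e_2,e_3)=1$ (all other products $g(e_i,e_j)$, $i\le j$, being zero) and $$[e_1,e_2]=0,\quad [e_1,e_3]=\alpha e_1+\beta e_2,\quad [e_2,e_3]=\gamma e_1+\delta e_2,$$ for some $\alpha,\beta,\gamma,\delta\in\mathbb{R}$ with $\alpha+\delta\neq0$ and $\alpha\gamma=0$. If there exist a left-invariant vector field $X$ on $G$ and $\lambda\in\mathbb{R}$ with $\mathcal{L}_Xg+C=\lambda g$, then $C=0$ (the left-invariant Cotton soliton is trivial).
   Context: Let $\nabla$ be the Levi-Civita connection of a three-dimensional pseudo-Riemannian manifold, $R(X,Y)=\nabla_{[X,Y]}-[\nabla_X,\nabla_Y]$, Ricci tensor $\rho(X,Y)=\operatorname{trace}\{Z\mapsto R(X,Z)Y\}$, scalar curvature $\tau$, Schouten tensor $S=\rho-\frac{\tau}{4}g$. The $(0,3)$-Cotton tensor is $C_{ijk}=(\nabla_iS)_{jk}-(\nabla_jS)_{ik}$, and the $(0,2)$-Cotton tensor is $C_{ij}=\frac{1}{2\sqrt{|\det g|}}C_{nmi}\,\epsilon^{nm\ell}g_{\ell j}$ with respect to positively oriented bases for a chosen orientation, where $\epsilon^{ijk}$ is the Levi-Civita symbol with $\epsilon^{123}=1$. A Cotton soliton is a vector field $X$ satisfying $\mathcal{L}_Xg+C=\lambda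 g$ for some $\lambda\in\mathbb{R}$; it is called trivial if $C=0$. *)

theory Defs
  imports "HOL-Analysis.Analysis" "HOL-Algebra.Group"
begin

text \<open>Only meaningful for open \<open>S\<close>; all iterated directional derivatives are required to exist
  and to be continuous.\<close>

primrec Ck_on :: "nat \<Rightarrow> 'a::real_normed_vector set \<Rightarrow> ('a \<Rightarrow> 'b::real_normed_vector) \<Rightarrow> bool" where
  "Ck_on 0 S f \<longleftrightarrow> continuous_on S f"
| "Ck_on (Suc k) S f \<longleftrightarrow>
     (\<forall>x\<in>S. f differentiable (at x)) \<and> (\<forall>v. Ck_on k S (\<lambda>x. frechet_derivative f (at x) v))"

definition smooth_on :: "'a::real_normed_vector set \<Rightarrow> ('a \<Rightarrow> 'b::real_normed_vector) \<Rightarrow> bool" where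
  "smooth_on S f \<longleftrightarrow> (\<forall>k. Ck_on k S f)"

text \<open>The manifold is the whole type \<open>'a\<close>; Hausdorffness and second countability are imposed by
  the sort constraint in the theorem. A smooth structure is given by any smooth atlas.\<close>

type_synonym 'a atlas = "('a set \<times> ('a \<Rightarrow> real^3)) set"

definition smooth_atlas :: "'a::topological_space atlas \<Rightarrow> bool" where
  "smooth_atlas A \<longleftrightarrow>
     (\<forall>(U, \<phi>)\<in>A. open U \<and> open (\<phi> ` U) \<and> homeomorphism U (\<phi> ` U) \<phi> (inv_into U \<phi>)) \<and>
     (\<Union>(U, \<phi>)\<in>A. U) = UNIV \<and>
     (\<forall>(U, \<phi>)\<in>A. \<forall>(V, \<psi>)\<in>A. smooth_on (\<phi> ` (U \<inter> V)) (\<lambda>x. \<psi> (inv_into U \<phi> x)))"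

definition smooth_functions :: "'a atlas \<Rightarrow> ('a \<Rightarrow> real) set" where
  "smooth_functions A = {f. \<forall>(U, \<phi>)\<in>A. smooth_on (\<phi> ` U) (\<lambda>x. f (inv_into U \<phi> x))}"

definition lie_group :: "'a::topological_space monoid \<Rightarrow> 'a atlas \<Rightarrow> bool" where
  "lie_group G A \<longleftrightarrow>
     group G \<and> carrier G = UNIV \<and> smooth_atlas A \<and>
     continuous_on UNIV (\<lambda>(p, q). p \<otimes>\<^bsub>G\<^esub> q) \<and>
     continuous_on UNIV (\<lambda>p. inv\<^bsub>G\<^esub> p) \<and>
     (\<forall>(U, \<phi>)\<in>A. \<forall>(V, \<psi>)\<in>A. \<forall>(W, \<theta>)\<in>A.
        smooth_on {(x, y). x \<in> \<phi> ` U \<and> y \<in> \<psi> ` V \<and> inv_into U \<phi> x \<otimes>\<^bsub>G\<^esub> inv_into V \<psi> y \<in> W}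
          (\<lambda>(x, y). \<theta> (inv_into U \<phi> x \<otimes>\<^bsub>G\<^esub> inv_into V \<psi> y))) \<and>
     (\<forall>(U, \<phi>)\<in>A. \<forall>(V, \<psi>)\<in>A.
        smooth_on {x. x \<in> \<phi> ` U \<and> inv\<^bsub>G\<^esub> (inv_into U \<phi> x) \<in> V}
          (\<lambda>x. \<psi> (inv\<^bsub>G\<^esub> (inv_into U \<phi> x))))"

text \<open>A tangent vector at \<open>p\<close> is a derivation at \<open>p\<close> of the algebra of smooth functions. It is
  set to \<open>0\<close> on non-smooth functions, so that equality of tangent vectors is equality in HOL.\<close>

type_synonym 'a tangent = "('a \<Rightarrow> real) \<Rightarrow> real"
type_synonym 'a vfield = "'a \<Rightarrow> 'a tangent"

definition tangent_space :: "'a atlas \<Rightarrow> 'a \<Rightarrow> 'a tangent set" where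
  "tangent_space A p = {v.
     (\<forall>f. f \<notin> smooth_functions A \<longrightarrow> v f = 0) \<and>
     (\<forall>f\<in>smooth_functions A. \<forall>h\<in>smooth_functions A. \<forall>a b.
        v (\<lambda>q. a * f q + b * h q) = a * v f + b * v h) \<and>
     (\<forall>f\<in>smooth_functions A. \<forall>h\<in>smooth_functions A.
        v (\<lambda>q. f q * h q) = f p * v h + h p * v f)}"

definition vector_fields :: "'a atlas \<Rightarrow> 'a vfield set" where
  "vector_fields A = {X. (\<forall>p. X p \<in> tangent_space A p) \<and>
     (\<forall>f\<in>smooth_functions A. (\<lambda>p. X p f) \<in> smooth_functions A)}"

definition vadd :: "'a vfield \<Rightarrow> 'a vfield \<Rightarrow> 'a vfield" where
  "vadd X Y = (\<lambda>p f. X p f + Y p f)"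

definition vmult :: "('a \<Rightarrow> real) \<Rightarrow> 'a vfield \<Rightarrow> 'a vfield" where
  "vmult h X = (\<lambda>p f. h p * X p f)"

definition bracket :: "'a vfield \<Rightarrow> 'a vfield \<Rightarrow> 'a vfield" where
  "bracket X Y = (\<lambda>p f. X p (\<lambda>q. Y q f) - Y p (\<lambda>q. X q f))"

definition basis_at :: "'a atlas \<Rightarrow> 'a \<Rightarrow> (3 \<Rightarrow> 'a tangent) \<Rightarrow> bool" where
  "basis_at A p b \<longleftrightarrow> (\<forall>i. b i \<in> tangent_space A p) \<and>
     (\<forall>v\<in>tangent_space A p. \<exists>!c::real^3. v = (\<lambda>f. \<Sum>i\<in>UNIV. c $ i * b i f))"

definition coords :: "(3 \<Rightarrow> 'a tangent) \<Rightarrow> 'a tangent \<Rightarrow> real^3" where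
  "coords b v = (THE c. v = (\<lambda>f. \<Sum>i\<in>UNIV. c $ i * b i f))"

text \<open>A (globally defined) triple of vector fields that is a frame near \<open>p\<close>.\<close>

definition frame_at :: "'a atlas \<Rightarrow> 'a \<Rightarrow> (3 \<Rightarrow> 'a vfield) \<Rightarrow> bool" where
  "frame_at A p b \<longleftrightarrow> (\<forall>i. b i \<in> vector_fields A) \<and> basis_at A p (\<lambda>i. b i p)"

text \<open>The differential of the left translation \<open>q \<mapsto> x \<otimes> q\<close>.\<close>

definition left_push :: "'a monoid \<Rightarrow> 'a \<Rightarrow> 'a tangent \<Rightarrow> 'a tangent" where
  "left_push G x v = (\<lambda>f. v (\<lambda>q. f (x \<otimes>\<^bsub>G\<^esub> q)))"

definition left_invariant_fields :: "'a monoid \<Rightarrow> 'a atlas \<Rightarrow> 'a vfield set" where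
  "left_invariant_fields G A =
     {X \<in> vector_fields A. \<forall>x p. X (x \<otimes>\<^bsub>G\<^esub> p) = left_push G x (X p)}"

text \<open>Bases of the Lie algebra of \<open>G\<close>, i.e. of the real vector space of left-invariant fields.\<close>

definition lie_algebra_basis :: "'a monoid \<Rightarrow> 'a atlas \<Rightarrow> (3 \<Rightarrow> 'a vfield) \<Rightarrow> bool" where
  "lie_algebra_basis G A e \<longleftrightarrow> (\<forall>i. e i \<in> left_invariant_fields G A) \<and>
     (\<forall>X\<in>left_invariant_fields G A. \<exists>!c::real^3. X = (\<lambda>p f. \<Sum>i\<in>UNIV. c $ i * e i p f))"

type_synonym 'a metric = "'a \<Rightarrow> 'a tangent \<Rightarrow> 'a tangent \<Rightarrow> real"

definition inner_fields :: "'a metric \<Rightarrow> 'a vfield \<Rightarrow> 'a vfield \<Rightarrow> 'a \<Rightarrow> real" where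
  "inner_fields g X Y = (\<lambda>p. g p (X p) (Y p))"

definition pseudo_riemannian :: "'a atlas \<Rightarrow> 'a metric \<Rightarrow> bool" where
  "pseudo_riemannian A g \<longleftrightarrow>
     (\<forall>p. \<forall>u\<in>tangent_space A p. \<forall>v\<in>tangent_space A p. g p u v = g p v u) \<and>
     (\<forall>p. \<forall>u\<in>tangent_space A p. \<forall>v\<in>tangent_space A p. \<forall>w\<in>tangent_space A p. \<forall>a b.
        g p (\<lambda>f. a * u f + b * v f) w = a * g p u w + b * g p v w) \<and>
     (\<forall>p. \<forall>u\<in>tangent_space A p. (\<forall>v\<in>tangent_space A p. g p u v = 0) \<longrightarrow> u = (\<lambda>f. 0)) \<and>
     (\<forall>X\<in>vector_fields A. \<forall>Y\<in>vector_fields A. inner_fields g X Y \<in> smooth_functions A)"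

text \<open>Signature \<open>(+,+,-)\<close>.\<close>

definition lorentzian :: "'a atlas \<Rightarrow> 'a metric \<Rightarrow> bool" where
  "lorentzian A g \<longleftrightarrow> pseudo_riemannian A g \<and>
     (\<forall>p. \<exists>b. basis_at A p b \<and>
        (\<forall>i j. g p (b i) (b j) = (if i \<noteq> j then 0 else if i = 3 then -1 else 1)))"

definition left_invariant_metric :: "'a monoid \<Rightarrow> 'a atlas \<Rightarrow> 'a metric \<Rightarrow> bool" where
  "left_invariant_metric G A g \<longleftrightarrow>
     (\<forall>x p. \<forall>u\<in>tangent_space A p. \<forall>v\<in>tangent_space A p.
        g (x \<otimes>\<^bsub>G\<^esub> p) (left_push G x u) (left_push G x v) = g p u v)"

text \<open>\<open>Or p\<close> is the set of positively oriented ordered bases of the tangent space at \<open>p\<close>: one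
  class of bases modulo change of basis with positive determinant, containing near each point the
  values of a smooth local frame.\<close>

definition orientation :: "'a::topological_space atlas \<Rightarrow> ('a \<Rightarrow> (3 \<Rightarrow> 'a tangent) set) \<Rightarrow> bool" where
  "orientation A Or \<longleftrightarrow>
     (\<forall>p. Or p \<noteq> {} \<and> (\<forall>b\<in>Or p. basis_at A p b) \<and>
        (\<forall>b\<in>Or p. \<forall>b'. basis_at A p b' \<longrightarrow>
           (b' \<in> Or p \<longleftrightarrow> det (\<chi> i j. coords b (b' j) $ i) > 0))) \<and>
     (\<forall>p. \<exists>U E. open U \<and> p \<in> U \<and> (\<forall>i. E i \<in> vector_fields A) \<and>
        (\<forall>q\<in>U. (\<lambda>i. E i q) \<in> Or q))"

type_synonym 'a connection = "'a vfield \<Rightarrow> 'a vfield \<Rightarrow> 'a vfield"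

definition affine_connection :: "'a atlas \<Rightarrow> 'a connection \<Rightarrow> bool" where
  "affine_connection A D \<longleftrightarrow>
     (\<forall>X\<in>vector_fields A. \<forall>Y\<in>vector_fields A. D X Y \<in> vector_fields A) \<and>
     (\<forall>X\<in>vector_fields A. \<forall>X'\<in>vector_fields A. \<forall>Y\<in>vector_fields A.
        D (vadd X X') Y = vadd (D X Y) (D X' Y)) \<and>
     (\<forall>X\<in>vector_fields A. \<forall>Y\<in>vector_fields A. \<forall>Y'\<in>vector_fields A.
        D X (vadd Y Y') = vadd (D X Y) (D X Y')) \<and>
     (\<forall>h\<in>smooth_functions A. \<forall>X\<in>vector_fields A. \<forall>Y\<in>vector_fields A.
        D (vmult h X) Y = vmult h (D X Y) \<and>
        D X (vmult h Y) = vadd (vmult (\<lambda>p. X p h) Y) (vmult h (D X Y)))"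

text \<open>On smooth fields \<open>D\<close> is uniquely determined by these conditions.\<close>

definition levi_civita :: "'a atlas \<Rightarrow> 'a metric \<Rightarrow> 'a connection \<Rightarrow> bool" where
  "levi_civita A g D \<longleftrightarrow> affine_connection A D \<and>
     (\<forall>X\<in>vector_fields A. \<forall>Y\<in>vector_fields A.
        bracket X Y = (\<lambda>p f. D X Y p f - D Y X p f)) \<and>
     (\<forall>X\<in>vector_fields A. \<forall>Y\<in>vector_fields A. \<forall>Z\<in>vector_fields A. \<forall>p.
        X p (inner_fields g Y Z) = inner_fields g (D X Y) Z p + inner_fields g Y (D X Z) p)"

text \<open>The sign convention is \<open>R(X,Y) = D[X,Y] - [DX,DY]\<close>.\<close>

definition curv :: "'a connection \<Rightarrow> 'a vfield \<Rightarrow> 'a vfield \<Rightarrow> 'a vfield \<Rightarrow> 'a vfield" where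
  "curv D X Y Z = (\<lambda>p f. D (bracket X Y) Z p f - (D X (D Y Z) p f - D Y (D X Z) p f))"

text \<open>Trace at \<open>p\<close> of an endomorphism of the vector fields that is linear over the smooth
  functions. Here, and in the two definitions by \<open>SOME\<close> below, the result does not depend on the
  chosen frame.\<close>

definition trace_at :: "'a atlas \<Rightarrow> 'a \<Rightarrow> ('a vfield \<Rightarrow> 'a vfield) \<Rightarrow> real" where
  "trace_at A p T = (let b = (SOME b. frame_at A p b) in
     \<Sum>i\<in>UNIV. coords (\<lambda>k. b k p) (T (b i) p) $ i)"

definition ricci :: "'a atlas \<Rightarrow> 'a connection \<Rightarrow> 'a vfield \<Rightarrow> 'a vfield \<Rightarrow> 'a \<Rightarrow> real" where
  "ricci A D X Y p = trace_at A p (\<lambda>Z. curv D X Z Y)"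

definition scalar_curvature :: "'a atlas \<Rightarrow> 'a metric \<Rightarrow> 'a connection \<Rightarrow> 'a \<Rightarrow> real" where
  "scalar_curvature A g D p = (let b = (SOME b. frame_at A p b) in
     \<Sum>i\<in>UNIV. \<Sum>j\<in>UNIV.
       matrix_inv (\<chi> k l. inner_fields g (b k) (b l) p) $ i $ j * ricci A D (b i) (b j) p)"

definition schouten ::
  "'a atlas \<Rightarrow> 'a metric \<Rightarrow> 'a connection \<Rightarrow> 'a vfield \<Rightarrow> 'a vfield \<Rightarrow> 'a \<Rightarrow> real" where
  "schouten A g D X Y p = ricci A D X Y p - scalar_curvature A g D p / 4 * inner_fields g X Y p"

definition cov_deriv2 :: "'a connection \<Rightarrow> ('a vfield \<Rightarrow> 'a vfield \<Rightarrow> 'a \<Rightarrow> real) \<Rightarrow>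
    'a vfield \<Rightarrow> 'a vfield \<Rightarrow> 'a vfield \<Rightarrow> 'a \<Rightarrow> real" where
  "cov_deriv2 D T X Y Z p = X p (T Y Z) - T (D X Y) Z p - T Y (D X Z) p"

definition cotton03 :: "'a atlas \<Rightarrow> 'a metric \<Rightarrow> 'a connection \<Rightarrow>
    'a vfield \<Rightarrow> 'a vfield \<Rightarrow> 'a vfield \<Rightarrow> 'a \<Rightarrow> real" where
  "cotton03 A g D X Y Z p =
     cov_deriv2 D (schouten A g D) X Y Z p - cov_deriv2 D (schouten A g D) Y X Z p"

definition levi_civita_symbol :: "3 \<Rightarrow> 3 \<Rightarrow> 3 \<Rightarrow> real" where
  "levi_civita_symbol i j k =
     (if (i, j, k) \<in> {(1, 2, 3), (2, 3, 1), (3, 1, 2)} then 1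
      else if (i, j, k) \<in> {(1, 3, 2), (2, 1, 3), (3, 2, 1)} then -1
      else 0)"

definition cotton02_component :: "'a atlas \<Rightarrow> 'a metric \<Rightarrow> 'a connection \<Rightarrow>
    (3 \<Rightarrow> 'a vfield) \<Rightarrow> 'a \<Rightarrow> 3 \<Rightarrow> 3 \<Rightarrow> real" where
  "cotton02_component A g D b p i j =
     1 / (2 * sqrt \<bar>det (\<chi> k l. inner_fields g (b k) (b l) p)\<bar>) *
     (\<Sum>n\<in>UNIV. \<Sum>m\<in>UNIV. \<Sum>l\<in>UNIV.
        cotton03 A g D (b n) (b m) (b i) p * levi_civita_symbol n m l * inner_fields g (b l) (b j) p)"

definition cotton02 :: "'a atlas \<Rightarrow> 'a metric \<Rightarrow> 'a connection \<Rightarrow> ('a \<Rightarrow> (3 \<Rightarrow> 'a tangent) set) \<Rightarrow>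
    'a \<Rightarrow> 'a tangent \<Rightarrow> 'a tangent \<Rightarrow> real" where
  "cotton02 A g D Or p u v =
     (let b = (SOME b. frame_at A p b \<and> (\<lambda>k. b k p) \<in> Or p) in
      \<Sum>i\<in>UNIV. \<Sum>j\<in>UNIV.
        coords (\<lambda>k. b k p) u $ i * coords (\<lambda>k. b k p) v $ j * cotton02_component A g D b p i j)"

definition lie_derivative_metric ::
  "'a metric \<Rightarrow> 'a vfield \<Rightarrow> 'a vfield \<Rightarrow> 'a vfield \<Rightarrow> 'a \<Rightarrow> real" where
  "lie_derivative_metric g X Y Z p =
     X p (inner_fields g Y Z) - inner_fields g (bracket X Y) Z p - inner_fields g Y (bracket X Z) p"

definition cotton_soliton :: "'a atlas \<Rightarrow> 'a metric \<Rightarrow> 'a connection \<Rightarrow>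
    ('a \<Rightarrow> (3 \<Rightarrow> 'a tangent) set) \<Rightarrow> 'a vfield \<Rightarrow> real \<Rightarrow> bool" where
  "cotton_soliton A g D Or X \<mu> \<longleftrightarrow> X \<in> vector_fields A \<and>
     (\<forall>Y\<in>vector_fields A. \<forall>Z\<in>vector_fields A. \<forall>p.
        lie_derivative_metric g X Y Z p + cotton02 A g D Or p (Y p) (Z p) = \<mu> * inner_fields g Y Z p)"

definition cotton_flat :: "'a atlas \<Rightarrow> 'a metric \<Rightarrow> 'a connection \<Rightarrow>
    ('a \<Rightarrow> (3 \<Rightarrow> 'a tangent) set) \<Rightarrow> bool" where
  "cotton_flat A g D Or \<longleftrightarrow>
     (\<forall>p. \<forall>u\<in>tangent_space A p. \<forall>v\<in>tangent_space A p. cotton02 A g D Or p u v = 0)"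

end

theory Submission
  imports Defs
begin

text \<open>Write \<open>c = (c\<^sub>1, c\<^sub>2, c\<^sub>3)\<close> for the constant components of the left-invariant field \<open>X\<close>
  in the frame \<open>e\<close>. In this frame the soliton equation is a system of equations between real
  numbers. Three of its six entries, at \<open>(1,1)\<close>, \<open>(1,2)\<close> and \<open>(2,3)\<close>, decide everything. All
  coefficients of the Cotton tensor are divisible by \<open>\<gamma>\<close>, so it vanishes for \<open>\<gamma> = 0\<close>. If
  \<open>\<gamma> \<noteq> 0\<close>, then \<open>\<alpha> = 0\<close>, and the three entries become
  \<open>\<kappa> \<gamma>\<^sup>3 = \<mu>\<close>, \<open>\<gamma> c\<^sub>3 = 0\<close> and \<open>\<kappa> \<gamma>\<^sup>3 / 2 - \<delta> c\<^sub>3 = -\<mu>\<close>, where \<open>\<kappa> \<noteq> 0\<close> records the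
  orientation. Then \<open>c\<^sub>3 = 0\<close>, the first and the third give \<open>\<kappa> \<gamma>\<^sup>3 / 2 = - \<kappa> \<gamma>\<^sup>3\<close>, and this
  contradicts \<open>\<gamma> \<noteq> 0\<close>. So a left-invariant soliton exists only when \<open>\<gamma> = 0\<close>.

  Most of the work is the passage from fields on the manifold to these numbers. The frame \<open>e\<close> is
  global and its Gram matrix is constant, so a vector field is the same thing as a smooth map to
  \<open>\<real>\<^sup>3\<close>, with components that are inner products with the \<open>e\<^sub>i\<close>. In these components
  the connection is the derivative of the components plus a constant bilinear map \<open>\<Gamma>\<close>
  (\<open>D_frame_comp\<close>). In the curvature and in the covariant derivative of the Schouten tensor the
  derivatives cancel (\<open>curv_frame_comp\<close>, \<open>cov_deriv2_schouten\<close>). What remains is multilinear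
  algebra on \<open>\<real>\<^sup>3\<close>, collected in the \<open>model_\<close> functions of \<open>\<Gamma>\<close>. The traces and the
  \<open>(0,2)\<close>-Cotton tensor are defined through an arbitrary frame; the change-of-basis arguments are
  \<open>trace_at_eq\<close>, \<open>scalar_curvature_eq\<close> and \<open>cotton02_eq\<close>. The last of these gives
  the Cotton tensor at one point up to a nonzero factor, and this suffices because the
  contradiction above is reached at a single point.\<close>

section \<open>The algebra of smooth functions\<close>

text \<open>Openness of \<open>S\<close> is essential here: the derivatives at a point of \<open>S\<close> see a whole
  neighbourhood, and only there do \<open>f\<close> and \<open>g\<close> agree. The lemma allows replacing the derivative of
  a sum or product, known only on \<open>S\<close>, by the formula for it.\<close>

lemma Ck_on_cong:
  assumes "open S" and "Ck_on k S f" and "\<And>x. x \<in> S \<Longrightarrow> f x = g x"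
  shows "Ck_on k S g"
  using assms(2,3)
proof (induction k arbitrary: f g)
  case 0
  then show ?case by (simp cong: continuous_on_cong)
next
  case (Suc k)
  have deriv: "(g has_derivative frechet_derivative f (at x)) (at x)" if "x \<in> S" for x
    using has_derivative_transform_within_open[OF _ \<open>open S\<close> that Suc.prems(2)]
      Suc.prems(1) that by (simp add: frechet_derivative_works[symmetric])
  have "frechet_derivative g (at x) = frechet_derivative f (at x)" if "x \<in> S" for x
    using frechet_derivative_at[OF deriv[OF that]] by simp
  moreover have "Ck_on k S (\<lambda>x. frechet_derivative f (at x) v)" for v
    using Suc.prems(1) by simp
  ultimately have "Ck_on k S (\<lambda>x. frechet_derivative g (at x) v)" for v
    using Suc.IH[of "\<lambda>x. frechet_derivative f (at x) v" "\<lambda>x. frechet_derivative g (at x) v"]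
    by simp
  then show ?case
    using deriv by (auto simp: differentiable_def)
qed

lemma Ck_on_const: "Ck_on k S (\<lambda>x. c)"
  by (induction k arbitrary: c) simp_all

lemma Ck_on_SucD:
  assumes "Ck_on (Suc k) S f"
  shows "Ck_on k S f"
  using assms
proof (induction k arbitrary: f)
  case 0
  then show ?case
    by (auto intro!: continuous_at_imp_continuous_on differentiable_imp_continuous_within)
next
  case (Suc k)
  then show ?case by (metis Ck_on.simps(2))
qed

lemma Ck_on_add:
  assumes "open S" and "Ck_on k S f" and "Ck_on k S g"
  shows "Ck_on k S (\<lambda>x. f x + g x)"
  using assms(2,3)
proof (induction k arbitrary: f g)
  case 0
  then show ?case by (simp add: continuous_on_add)
next
  case (Suc k)
  have deriv: "((\<lambda>y. f y + g y) has_derivative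
      (\<lambda>v. frechet_derivative f (at x) v + frechet_derivative g (at x) v)) (at x)"
    if "x \<in> S" for x
  proof (rule has_derivative_add)
    show "(f has_derivative frechet_derivative f (at x)) (at x)"
      "(g has_derivative frechet_derivative g (at x)) (at x)"
      using Suc.prems that by (simp_all add: frechet_derivative_works[symmetric])
  qed
  have "Ck_on k S (\<lambda>x. frechet_derivative (\<lambda>y. f y + g y) (at x) v)" for v
  proof (rule Ck_on_cong[OF \<open>open S\<close>])
    show "Ck_on k S (\<lambda>x. frechet_derivative f (at x) v + frechet_derivative g (at x) v)"
      using Suc.IH Suc.prems by simp
    show "frechet_derivative f (at x) v + frechet_derivative g (at x) v =
        frechet_derivative (\<lambda>y. f y + g y) (at x) v" if "x \<in> S" for x
      by (rule fun_cong[OF frechet_derivative_at[OF deriv[OF that]]])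
  qed
  moreover have "(\<lambda>y. f y + g y) differentiable (at x)" if "x \<in> S" for x
    using deriv[OF that] by (rule differentiableI)
  ultimately show ?case by simp
qed

text \<open>In the induction the derivative \<open>f x * g' v + f' v * g x\<close> is a sum of products of functions of
  class \<open>C\<^sup>k\<close>; the undifferentiated factors have this class by \<open>Ck_on_SucD\<close>.\<close>

lemma Ck_on_mult:
  fixes f g :: "'a::real_normed_vector \<Rightarrow> 'b::real_normed_algebra"
  assumes "open S" and "Ck_on k S f" and "Ck_on k S g"
  shows "Ck_on k S (\<lambda>x. f x * g x)"
  using assms(2,3)
proof (induction k arbitrary: f g)
  case 0
  then show ?case by (simp add: continuous_on_mult)
next
  case (Suc k)
  have deriv: "((\<lambda>y. f y * g y) has_derivative
      (\<lambda>v. f x * frechet_derivative g (at x) v + frechet_derivative f (at x) v * g x)) (at x)"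
    if "x \<in> S" for x
  proof (rule has_derivative_mult)
    show "(f has_derivative frechet_derivative f (at x)) (at x)"
      "(g has_derivative frechet_derivative g (at x)) (at x)"
      using Suc.prems that by (simp_all add: frechet_derivative_works[symmetric])
  qed
  have "Ck_on k S (\<lambda>x. frechet_derivative (\<lambda>y. f y * g y) (at x) v)" for v
  proof (rule Ck_on_cong[OF \<open>open S\<close>])
    show "Ck_on k S (\<lambda>x. f x * frechet_derivative g (at x) v
        + frechet_derivative f (at x) v * g x)"
      using Suc.prems Suc.prems[THEN Ck_on_SucD]
      by (intro Ck_on_add[OF \<open>open S\<close>] Suc.IH) simp_all
    show "f x * frechet_derivative g (at x) v + frechet_derivative f (at x) v * g x =
        frechet_derivative (\<lambda>y. f y * g y) (at x) v" if "x \<in> S" for x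
      by (rule fun_cong[OF frechet_derivative_at[OF deriv[OF that]]])
  qed
  moreover have "(\<lambda>y. f y * g y) differentiable (at x)" if "x \<in> S" for x
    using deriv[OF that] by (rule differentiableI)
  ultimately show ?case by simp
qed

locale manifold =
  fixes A :: "'a::topological_space atlas"
  assumes atlas: "smooth_atlas A"
begin

lemma chart_open: "(U, \<phi>) \<in> A \<Longrightarrow> open (\<phi> ` U)"
  using atlas by (auto simp: smooth_atlas_def)

lemma smooth_const [simp]: "(\<lambda>q. c) \<in> smooth_functions A"
  by (simp add: smooth_functions_def smooth_on_def Ck_on_const)

lemma smooth_add [simp]:
  "f \<in> smooth_functions A \<Longrightarrow> h \<in> smooth_functions A \<Longrightarrow>
    (\<lambda>q. f q + h q) \<in> smooth_functions A"
  unfolding smooth_functions_def smooth_on_def using Ck_on_add[OF chart_open] by blast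

lemma smooth_mult [simp]:
  "f \<in> smooth_functions A \<Longrightarrow> h \<in> smooth_functions A \<Longrightarrow>
    (\<lambda>q. f q * h q) \<in> smooth_functions A"
  unfolding smooth_functions_def smooth_on_def using Ck_on_mult[OF chart_open] by blast

lemma smooth_uminus [simp]:
  "f \<in> smooth_functions A \<Longrightarrow> (\<lambda>q. - f q) \<in> smooth_functions A"
  using smooth_mult[OF smooth_const[of "-1"]] by simp

lemma smooth_diff [simp]:
  "f \<in> smooth_functions A \<Longrightarrow> h \<in> smooth_functions A \<Longrightarrow>
    (\<lambda>q. f q - h q) \<in> smooth_functions A"
  using smooth_add[OF _ smooth_uminus] by simp

lemma smooth_sum [simp]:
  "(\<And>i. i \<in> I \<Longrightarrow> f i \<in> smooth_functions A) \<Longrightarrow>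
    (\<lambda>q. \<Sum>i\<in>I. f i q) \<in> smooth_functions A"
  by (induction I rule: infinite_finite_induct) auto

section \<open>Tangent vectors and vector fields\<close>

abbreviation "T p \<equiv> tangent_space A p"
abbreviation "VF \<equiv> vector_fields A"

lemma tangent_lincomb:
  assumes "v \<in> T p" "f \<in> smooth_functions A" "h \<in> smooth_functions A"
  shows "v (\<lambda>q. a * f q + b * h q) = a * v f + b * v h"
  using assms by (simp add: tangent_space_def)

lemma tangent_mult:
  assumes "v \<in> T p" "f \<in> smooth_functions A" "h \<in> smooth_functions A"
  shows "v (\<lambda>q. f q * h q) = f p * v h + h p * v f"
  using assms by (simp add: tangent_space_def)

lemma tangent_add:
  assumes "v \<in> T p" "f \<in> smooth_functions A" "h \<in> smooth_functions A"
  shows "v (\<lambda>q. f q + h q) = v f + v h"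
  using tangent_lincomb[OF assms, of 1 1] by simp

lemma tangent_uminus:
  assumes "v \<in> T p" "f \<in> smooth_functions A"
  shows "v (\<lambda>q. - f q) = - v f"
  using tangent_lincomb[OF assms(1,2) smooth_const, of "-1" 0 0] by simp

lemma tangent_const [simp]:
  assumes "v \<in> T p"
  shows "v (\<lambda>q. c) = 0"
proof -
  have "v (\<lambda>q. 1 * 1) = 1 * v (\<lambda>q. 1) + 1 * v (\<lambda>q. 1)"
    using tangent_mult[OF assms smooth_const smooth_const] .
  then show ?thesis
    using tangent_lincomb[OF assms smooth_const smooth_const, of c 1 0 0] by simp
qed

lemma tangent_scale:
  assumes "v \<in> T p" "f \<in> smooth_functions A"
  shows "v (\<lambda>q. c * f q) = c * v f"
  using tangent_mult[OF assms(1) smooth_const assms(2), of c] assms by simp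

lemma tangent_sum:
  assumes "v \<in> T p" "\<And>i. i \<in> I \<Longrightarrow> f i \<in> smooth_functions A"
  shows "v (\<lambda>q. \<Sum>i\<in>I. f i q) = (\<Sum>i\<in>I. v (f i))"
  using assms(2)
  by (induction I rule: infinite_finite_induct)
    (simp_all add: tangent_add[OF assms(1)] tangent_const[OF assms(1)])

lemma zero_in_T [simp]: "(\<lambda>f. 0) \<in> T p"
  by (simp add: tangent_space_def)

lemma lincomb_in_T [simp]:
  assumes "u \<in> T p" "v \<in> T p"
  shows "(\<lambda>f. a * u f + b * v f) \<in> T p"
  using assms unfolding tangent_space_def by (auto simp: algebra_simps)

lemma add_in_T [simp]: "u \<in> T p \<Longrightarrow> v \<in> T p \<Longrightarrow> (\<lambda>f. u f + v f) \<in> T p"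
  using lincomb_in_T[of u p v 1 1] by simp

lemma diff_in_T [simp]: "u \<in> T p \<Longrightarrow> v \<in> T p \<Longrightarrow> (\<lambda>f. u f - v f) \<in> T p"
  using lincomb_in_T[of u p v 1 "-1"] by simp

lemma scale_in_T [simp]: "u \<in> T p \<Longrightarrow> (\<lambda>f. a * u f) \<in> T p"
  using lincomb_in_T[of u p u a 0] by simp

lemma sum_in_T [simp]:
  "(\<And>i. i \<in> I \<Longrightarrow> u i \<in> T p) \<Longrightarrow> (\<lambda>f. \<Sum>i\<in>I. c i * u i f) \<in> T p"
proof (induction I rule: infinite_finite_induct)
  case (insert i I)
  then show ?case using lincomb_in_T[of "u i" p "\<lambda>f. \<Sum>i\<in>I. c i * u i f" "c i" 1] by simp
qed simp_all

lemma VF_T: "X \<in> VF \<Longrightarrow> X p \<in> T p"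
  by (simp add: vector_fields_def)

lemma VF_smooth:
  "X \<in> VF \<Longrightarrow> f \<in> smooth_functions A \<Longrightarrow> (\<lambda>p. X p f) \<in> smooth_functions A"
  by (simp add: vector_fields_def)

lemma vadd_VF [simp]: "X \<in> VF \<Longrightarrow> Y \<in> VF \<Longrightarrow> vadd X Y \<in> VF"
  by (simp add: vector_fields_def vadd_def)

lemma vmult_VF [simp]: "h \<in> smooth_functions A \<Longrightarrow> X \<in> VF \<Longrightarrow> vmult h X \<in> VF"
  by (simp add: vector_fields_def vmult_def)

lemma diff_VF: "X \<in> VF \<Longrightarrow> Y \<in> VF \<Longrightarrow> (\<lambda>p f. X p f - Y p f) \<in> VF"
  by (simp add: vector_fields_def)

end

section \<open>The Lorentzian form on three-dimensional space\<close>

text \<open>The Gram matrix of the pseudo-orthonormal basis: \<open>e\<^sub>1\<close> is a unit vector, and \<open>e\<^sub>2\<close>, \<open>e\<^sub>3\<close> are null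
  vectors with product \<open>-1\<close>.\<close>

definition lorentz_form :: "real^3 \<Rightarrow> real^3 \<Rightarrow> real" where
  "lorentz_form x y = x$1 * y$1 - x$2 * y$3 - x$3 * y$2"

lemma bilinear_lorentz_form: "bilinear lorentz_form"
  by (auto simp: bilinear_def lorentz_form_def algebra_simps intro!: linearI)

lemma bilinear_expand:
  fixes B :: "real^'n \<Rightarrow> real^'m \<Rightarrow> real"
  assumes "bilinear B"
  shows "B x y = (\<Sum>i\<in>UNIV. \<Sum>j\<in>UNIV. x$i * y$j * B (axis i 1) (axis j 1))"
proof -
  have "B x y = B (\<Sum>i\<in>UNIV. x$i *s axis i 1) (\<Sum>j\<in>UNIV. y$j *s axis j 1)"
    by (simp add: basis_expansion)
  also have "\<dots> = (\<Sum>i\<in>UNIV. \<Sum>j\<in>UNIV. x$i * y$j * B (axis i 1) (axis j 1))"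
    using assms
    by (simp add: bilinear_sum sum.cartesian_product scalar_mult_eq_scaleR bilinear_lmul
        bilinear_rmul mult.assoc)
  finally show ?thesis .
qed

section \<open>Components in a frame with constant Gram matrix\<close>

locale lorentz_frame = manifold A for A :: "'a::topological_space atlas" +
  fixes g :: "'a metric" and e :: "3 \<Rightarrow> 'a vfield"
  assumes lorentz: "lorentzian A g"
    and e_VF: "\<And>i. e i \<in> vector_fields A"
    and gram: "\<And>p i j. g p (e i p) (e j p) = lorentz_form (axis i 1) (axis j 1)"
begin

lemma metric_sym: "u \<in> T p \<Longrightarrow> v \<in> T p \<Longrightarrow> g p u v = g p v u"
  using lorentz by (simp add: lorentzian_def pseudo_riemannian_def)

lemma metric_lincomb:
  "u \<in> T p \<Longrightarrow> v \<in> T p \<Longrightarrow> w \<in> T p \<Longrightarrow>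
    g p (\<lambda>f. a * u f + b * v f) w = a * g p u w + b * g p v w"
  using lorentz unfolding lorentzian_def pseudo_riemannian_def by blast

lemma metric_smooth:
  "X \<in> VF \<Longrightarrow> Y \<in> VF \<Longrightarrow> (\<lambda>p. g p (X p) (Y p)) \<in> smooth_functions A"
  using lorentz by (simp add: lorentzian_def pseudo_riemannian_def inner_fields_def)

lemma e_T: "e i p \<in> T p"
  by (rule VF_T[OF e_VF])

text \<open>The linear combination of the frame vectors at \<open>p\<close>; its inverse is \<open>frame_comp p\<close>, for which the
  dual frame with respect to the metric is \<open>(e\<^sub>1, -e\<^sub>3, -e\<^sub>2)\<close>.\<close>

definition combination :: "'a \<Rightarrow> real^3 \<Rightarrow> 'a tangent" where
  "combination p c = (\<lambda>f. \<Sum>i\<in>UNIV. c$i * e i p f)"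

definition frame_comp :: "'a \<Rightarrow> 'a tangent \<Rightarrow> real^3" where
  "frame_comp p v = vector [g p v (e 1 p), - g p v (e 3 p), - g p v (e 2 p)]"

lemma combination_T: "combination p c \<in> T p"
  unfolding combination_def by (rule sum_in_T) (rule e_T)

lemma frame_comp_lincomb:
  assumes "u \<in> T p" "v \<in> T p"
  shows "frame_comp p (\<lambda>f. a * u f + b * v f) = a *\<^sub>R frame_comp p u + b *\<^sub>R frame_comp p v"
  using metric_lincomb[OF assms e_T] by (simp add: frame_comp_def vec_eq_iff forall_3 algebra_simps)

lemma frame_comp_add:
  assumes "u \<in> T p" "v \<in> T p"
  shows "frame_comp p (\<lambda>f. u f + v f) = frame_comp p u + frame_comp p v"
  using frame_comp_lincomb[OF assms, of 1 1] by simp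

lemma frame_comp_diff:
  assumes "u \<in> T p" "v \<in> T p"
  shows "frame_comp p (\<lambda>f. u f - v f) = frame_comp p u - frame_comp p v"
  using frame_comp_lincomb[OF assms, of 1 "-1"] by simp

lemma frame_comp_scale:
  assumes "u \<in> T p"
  shows "frame_comp p (\<lambda>f. a * u f) = a *\<^sub>R frame_comp p u"
  using frame_comp_lincomb[OF assms assms, of a 0] by simp

lemma frame_comp_sum:
  assumes "\<And>i. i \<in> I \<Longrightarrow> u i \<in> T p"
  shows "frame_comp p (\<lambda>f. \<Sum>i\<in>I. c i * u i f) = (\<Sum>i\<in>I. c i *\<^sub>R frame_comp p (u i))"
  using assms
proof (induction I rule: infinite_finite_induct)
  case (insert i I)
  then have "frame_comp p (\<lambda>f. c i * u i f + (\<Sum>i\<in>I. c i * u i f))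
      = c i *\<^sub>R frame_comp p (u i) + frame_comp p (\<lambda>f. \<Sum>i\<in>I. c i * u i f)"
    by (subst frame_comp_add) (simp_all add: frame_comp_scale)
  with insert show ?case by simp
qed (use frame_comp_scale[OF zero_in_T, of p 0] in simp_all)

lemma frame_comp_e: "frame_comp p (e i p) = axis i 1"
  using exhaust_3[of i]
  by (auto simp: frame_comp_def gram lorentz_form_def vec_eq_iff forall_3 axis_def)

lemma frame_comp_combination: "frame_comp p (combination p c) = c"
  unfolding combination_def
  by (subst frame_comp_sum)
    (simp_all add: e_T frame_comp_e basis_expansion flip: scalar_mult_eq_scaleR)

text \<open>A dimension count. The Gram matrix is invertible, so the frame vectors are linearly
  independent; a Lorentzian metric comes with a basis of three tangent vectors at each point, so
  three independent vectors span.\<close>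

lemma combination_surj:
  assumes "v \<in> T p"
  obtains c where "v = combination p c"
proof -
  obtain b where b: "basis_at A p b"
    using lorentz unfolding lorentzian_def by blast
  then have "\<forall>u\<in>T p. \<exists>c::real^3. u = (\<lambda>f. \<Sum>j\<in>UNIV. c$j * b j f)"
    unfolding basis_at_def by blast
  then obtain k :: "'a tangent \<Rightarrow> real^3"
    where k: "\<And>u. u \<in> T p \<Longrightarrow> u = (\<lambda>f. \<Sum>j\<in>UNIV. k u $ j * b j f)"
    by metis
  define h where "h c = (\<Sum>i\<in>UNIV. c$i *\<^sub>R k (e i p))" for c :: "real^3"
  have h: "combination p c = (\<lambda>f. \<Sum>j\<in>UNIV. h c $ j * b j f)" for c
  proof
    fix f
    have "combination p c f = (\<Sum>i\<in>UNIV. c$i * (\<Sum>j\<in>UNIV. k (e i p) $ j * b j f))"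
      unfolding combination_def using k[OF e_T] by (metis (no_types, lifting))
    then show "combination p c f = (\<Sum>j\<in>UNIV. h c $ j * b j f)"
      unfolding h_def by (simp add: sum_3 algebra_simps)
  qed
  have lin: "linear h"
    unfolding h_def
    by (rule linearI) (simp_all add: scaleR_left_distrib sum.distrib scaleR_sum_right)
  have "c = d" if "h c = h d" for c d
    using h[of c] h[of d] that frame_comp_combination by metis
  then have "surj h"
    using lin by (intro linear_injective_imp_surjective) (auto simp: inj_def)
  then obtain c where "h c = k v"
    by (metis surjD)
  then show ?thesis
    using that h[of c] k[OF assms] by metis
qed

lemma combination_frame_comp:
  assumes "v \<in> T p"
  shows "combination p (frame_comp p v) = v"
  using combination_surj[OF assms] frame_comp_combination by metis

lemma frame_comp_inject:
  assumes "u \<in> T p" "v \<in> T p" "frame_comp p u = frame_comp p v"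
  shows "u = v"
  using combination_frame_comp assms by metis

lemma metric_frame_comp:
  assumes "u \<in> T p" "v \<in> T p"
  shows "g p u v = lorentz_form (frame_comp p u) (frame_comp p v)"
proof -
  have left: "g p (combination p c) (e j p) = lorentz_form c (axis j 1)" for c j
    using frame_comp_combination[of p c] exhaust_3[of j]
    by (auto simp: frame_comp_def lorentz_form_def vec_eq_iff forall_3 axis_def)
  have right: "g p w (combination p c) = (\<Sum>j\<in>UNIV. c$j * g p w (e j p))"
    if "w \<in> T p" for w c
  proof -
    have "g p (combination p c) w = (\<Sum>j\<in>UNIV. c$j * g p (e j p) w)"
      using metric_lincomb[OF lincomb_in_T[OF e_T e_T] e_T that, of 1 "c$1" 1 "c$2" 2 "c$3" 3]
        metric_lincomb[OF e_T e_T that, of "c$1" 1 "c$2" 2]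
      unfolding combination_def by (simp add: sum_3)
    then show ?thesis
      by (simp add: metric_sym[OF that combination_T] metric_sym[OF that e_T])
  qed
  have "g p (combination p c) (combination p d) = lorentz_form c d" for c d
    by (simp add: right[OF combination_T] left sum_3)
      (simp add: lorentz_form_def axis_def algebra_simps)
  then show ?thesis
    using combination_frame_comp assms by metis
qed

lemma smooth_frame_comp:
  assumes "X \<in> VF"
  shows "(\<lambda>p. frame_comp p (X p) $ i) \<in> smooth_functions A"
  using exhaust_3[of i] metric_smooth[OF assms e_VF] by (auto simp: frame_comp_def)

lemma basis_at_e: "basis_at A p (\<lambda>i. e i p)"
  unfolding basis_at_def
proof (intro conjI allI ballI)
  show "e i p \<in> T p" for i by (rule e_T)
  show "\<exists>!c::real^3. v = (\<lambda>f. \<Sum>i\<in>UNIV. c$i * e i p f)" if "v \<in> T p" for v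
  proof (rule ex1I[of _ "frame_comp p v"])
    show "v = (\<lambda>f. \<Sum>i\<in>UNIV. frame_comp p v $ i * e i p f)"
      using combination_frame_comp[OF that] unfolding combination_def by simp
    show "c = frame_comp p v" if "v = (\<lambda>f. \<Sum>i\<in>UNIV. c$i * e i p f)" for c
      using frame_comp_combination[of p c] that unfolding combination_def by simp
  qed
qed

lemma frame_at_e: "frame_at A p e"
  by (simp add: frame_at_def e_VF basis_at_e)

lemma basis_matrix:
  assumes "basis_at A p b"
  defines "B \<equiv> (\<chi> i k. frame_comp p (b k) $ i)"
  shows "invertible B" and "\<And>v. v \<in> T p \<Longrightarrow> frame_comp p v = B *v coords b v"
proof -
  have bT: "\<And>i. b i \<in> T p"
    and ex1: "\<And>v. v \<in> T p \<Longrightarrow> \<exists>!c::real^3. v = (\<lambda>f. \<Sum>i\<in>UNIV. c$i * b i f)"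
    using assms(1) unfolding basis_at_def by blast+
  have comp: "frame_comp p (\<lambda>f. \<Sum>i\<in>UNIV. c$i * b i f) = B *v c" for c :: "real^3"
    by (subst frame_comp_sum)
      (simp_all add: bT B_def matrix_vector_mult_def vec_eq_iff sum_3 algebra_simps)
  show "frame_comp p v = B *v coords b v" if "v \<in> T p" for v
  proof -
    have "v = (\<lambda>f. \<Sum>i\<in>UNIV. coords b v $ i * b i f)"
      unfolding coords_def by (rule theI'[OF ex1[OF that]])
    then have "frame_comp p v = frame_comp p (\<lambda>f. \<Sum>i\<in>UNIV. coords b v $ i * b i f)"
      by (rule arg_cong)
    then show ?thesis
      by (simp only: comp)
  qed
  have "c = 0" if "B *v c = 0" for c
  proof -
    have "(\<lambda>f. \<Sum>i\<in>UNIV. c$i * b i f) = (\<lambda>f. \<Sum>i\<in>UNIV. (0::real^3)$i * b i f)"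
      by (rule frame_comp_inject[of _ p], insert that)
        (simp_all only: comp matrix_vector_mult_0_right sum_in_T bT)
    moreover have "\<exists>!d::real^3. (\<lambda>f. \<Sum>i\<in>UNIV. c$i * b i f) = (\<lambda>f. \<Sum>i\<in>UNIV. d$i * b i f)"
      by (rule ex1[OF sum_in_T[OF bT]])
    ultimately show ?thesis by blast
  qed
  then show "invertible B"
    unfolding invertible_left_inverse matrix_left_invertible_ker by blast
qed

section \<open>Componentwise derivatives\<close>

definition derivative :: "'a tangent \<Rightarrow> ('a \<Rightarrow> real^3) \<Rightarrow> real^3" where
  "derivative v y = (\<chi> i. v (\<lambda>q. y q $ i))"

lemma derivative_const [simp]: "v \<in> T p \<Longrightarrow> derivative v (\<lambda>q. c) = 0"
  by (simp add: derivative_def vec_eq_iff)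

lemma derivative_add:
  assumes "v \<in> T p" "\<And>i. (\<lambda>q. y q $ i) \<in> smooth_functions A"
    "\<And>i. (\<lambda>q. z q $ i) \<in> smooth_functions A"
  shows "derivative v (\<lambda>q. y q + z q) = derivative v y + derivative v z"
  by (simp add: derivative_def vec_eq_iff tangent_add[OF assms(1) assms(2,3)])

lemma smooth_bilinear:
  fixes B :: "real^3 \<Rightarrow> real^3 \<Rightarrow> real"
  assumes "bilinear B" "\<And>i. (\<lambda>q. y q $ i) \<in> smooth_functions A"
    "\<And>i. (\<lambda>q. z q $ i) \<in> smooth_functions A"
  shows "(\<lambda>q. B (y q) (z q)) \<in> smooth_functions A"
  by (subst bilinear_expand[OF assms(1)]) (intro smooth_sum smooth_mult smooth_const assms)

text \<open>Expanded in the standard basis, \<open>B (y q) (z q)\<close> is a sum of products of smooth functions with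
  constant coefficients, so the Leibniz rule applies termwise.\<close>

lemma tangent_bilinear:
  fixes B :: "real^3 \<Rightarrow> real^3 \<Rightarrow> real"
  assumes B: "bilinear B" and v: "v \<in> T p"
    and y: "\<And>i. (\<lambda>q. y q $ i) \<in> smooth_functions A"
    and z: "\<And>i. (\<lambda>q. z q $ i) \<in> smooth_functions A"
  shows "v (\<lambda>q. B (y q) (z q)) = B (derivative v y) (z p) + B (y p) (derivative v z)"
proof -
  have "v (\<lambda>q. B (y q) (z q)) =
      v (\<lambda>q. \<Sum>i\<in>UNIV. \<Sum>j\<in>UNIV. B (axis i 1) (axis j 1) * (y q $ i * z q $ j))"
    by (subst bilinear_expand[OF B]) (simp add: algebra_simps)
  also have "\<dots> = (\<Sum>i\<in>UNIV. \<Sum>j\<in>UNIV. B (axis i 1) (axis j 1) *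
      (y p $ i * v (\<lambda>q. z q $ j) + z p $ j * v (\<lambda>q. y q $ i)))"
    by (simp add: tangent_sum[OF v] tangent_scale[OF v] tangent_mult[OF v] y z)
  also have "\<dots> = (\<Sum>i\<in>UNIV. \<Sum>j\<in>UNIV. derivative v y $ i * z p $ j * B (axis i 1) (axis j 1))
      + (\<Sum>i\<in>UNIV. \<Sum>j\<in>UNIV. y p $ i * derivative v z $ j * B (axis i 1) (axis j 1))"
    unfolding derivative_def by (simp add: sum.distrib[symmetric] algebra_simps)
  finally show ?thesis
    by (simp only: bilinear_expand[OF B, symmetric])
qed

end

section \<open>Traces are independent of the frame\<close>

lemma matrix_inv:
  fixes B :: "real^'n^'n"
  assumes "invertible B"
  shows "B ** matrix_inv B = mat 1" "matrix_inv B ** B = mat 1"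
  using someI_ex[OF assms[unfolded invertible_def]] unfolding matrix_inv_def by auto

lemma matrix_inv_unique:
  fixes B :: "real^'n^'n"
  assumes "B ** C = mat 1" "C ** B = mat 1"
  shows "matrix_inv B = C"
proof -
  have "invertible B"
    using assms unfolding invertible_def by blast
  then show ?thesis
    using matrix_inv(2)[of B] assms(1)
    by (metis matrix_mul_assoc matrix_mul_lid matrix_mul_rid)
qed

context lorentz_frame
begin

text \<open>In the frame picked by \<open>trace_at\<close> the endomorphism has the matrix \<open>B\<^sup>-\<^sup>1 M B\<close>, which has the trace
  of \<open>M\<close>. The hypothesis that \<open>F Z p\<close> depends linearly on \<open>Z p\<close> alone is what tensoriality of \<open>F\<close> means.\<close>

lemma trace_at_eq:
  assumes "\<And>Z. Z \<in> VF \<Longrightarrow> F Z p \<in> T p"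
    and "\<And>Z. Z \<in> VF \<Longrightarrow> frame_comp p (F Z p) = M *v frame_comp p (Z p)"
  shows "trace_at A p F = trace M"
proof -
  define b where "b = (SOME b. frame_at A p b)"
  have b: "frame_at A p b"
    unfolding b_def by (rule someI[of _ e]) (rule frame_at_e)
  define B where "B = (\<chi> i k. frame_comp p (b k p) $ i)"
  have bVF: "b k \<in> VF" for k
    using b by (simp add: frame_at_def)
  have basis: "basis_at A p (\<lambda>k. b k p)"
    using b by (simp add: frame_at_def)
  note B = basis_matrix[OF basis, folded B_def]
  have inv: "matrix_inv B ** B = mat 1" "B ** matrix_inv B = mat 1"
    using matrix_inv(1,2)[OF B(1)] by auto
  have "coords (\<lambda>k. b k p) (F (b i) p) $ i = (matrix_inv B ** M ** B) $ i $ i" for i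
  proof -
    have "M *v frame_comp p (b i p) = B *v coords (\<lambda>k. b k p) (F (b i) p)"
      using B(2)[OF assms(1)[OF bVF]] assms(2)[OF bVF] by simp
    then have "coords (\<lambda>k. b k p) (F (b i) p) = matrix_inv B *v (M *v frame_comp p (b i p))"
      by (simp add: matrix_vector_mul_assoc inv)
    also have "frame_comp p (b i p) = B *v axis i 1"
      by (simp add: B_def vec_eq_iff matrix_vector_mult_basis column_def)
    finally have "coords (\<lambda>k. b k p) (F (b i) p) = column i (matrix_inv B ** M ** B)"
      by (simp only: matrix_vector_mul_assoc matrix_mul_assoc
          flip: matrix_vector_mult_basis)
    then show ?thesis
      by (simp add: column_def)
  qed
  then have "trace_at A p F = trace (matrix_inv B ** M ** B)"
    by (simp add: trace_at_def trace_def Let_def flip: b_def)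
  also have "\<dots> = trace (B ** (matrix_inv B ** M))"
    by (rule trace_mul_sym)
  finally show ?thesis
    by (simp add: matrix_mul_assoc inv)
qed

definition gram_matrix :: "(3 \<Rightarrow> 'a vfield) \<Rightarrow> 'a \<Rightarrow> real^3^3" where
  "gram_matrix b p = (\<chi> k l. inner_fields g (b k) (b l) p)"

lemma bilinear_matrix:
  fixes h :: "real^'n \<Rightarrow> real^'n \<Rightarrow> real"
  assumes "bilinear h"
  shows "(\<chi> k l. h (column k B) (column l B)) =
    transpose B ** (\<chi> k l. h (axis k 1) (axis l 1)) ** B"
proof -
  have "h (column k B) (column l B) =
      (\<Sum>j\<in>UNIV. \<Sum>i\<in>UNIV. B$i$k * h (axis i 1) (axis j 1) * B$j$l)" for k l
    by (subst bilinear_expand[OF assms], subst sum.swap) (simp add: column_def mult_ac)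
  then show ?thesis
    by (simp add: vec_eq_iff matrix_matrix_mult_def transpose_def sum_distrib_right)
qed

lemma gram_matrix_e: "gram_matrix e p = (\<chi> k l. lorentz_form (axis k 1) (axis l 1))"
  by (simp add: gram_matrix_def inner_fields_def gram)

lemma det_gram_matrix_e: "det (gram_matrix e p) = -1"
  by (simp add: gram_matrix_e det_3 lorentz_form_def axis_def)

lemma gram_matrix_frame:
  assumes "frame_at A p b"
  defines "B \<equiv> (\<chi> i k. frame_comp p (b k p) $ i)"
  shows "gram_matrix b p = transpose B ** gram_matrix e p ** B"
proof -
  have "frame_comp p (b k p) = column k B" for k
    by (simp add: B_def column_def)
  then have "gram_matrix b p = (\<chi> k l. lorentz_form (column k B) (column l B))"
    using assms(1)
    by (simp add: gram_matrix_def inner_fields_def metric_frame_comp frame_at_def VF_T)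
  then show ?thesis
    by (simp add: bilinear_matrix[OF bilinear_lorentz_form] gram_matrix_e)
qed

text \<open>Contracting \<open>h\<close> with the inverse metric is taking the trace of \<open>N\<^sup>-\<^sup>1 H\<close>, where \<open>N\<close> is the Gram matrix
  and \<open>H\<close> the transposed matrix of \<open>h\<close>. A change of frame turns these into \<open>B\<^sup>T N B\<close> and \<open>B\<^sup>T H B\<close>, so
  the product is conjugated by \<open>B\<close>. The point of the formula is that its right-hand side does not
  mention \<open>p\<close>: the scalar curvature is constant.\<close>

lemma scalar_curvature_eq:
  assumes h: "bilinear h"
    and model_ricci: "\<And>X Y. X \<in> VF \<Longrightarrow> Y \<in> VF \<Longrightarrow>
      ricci A D X Y p = h (frame_comp p (X p)) (frame_comp p (Y p))"
  shows "scalar_curvature A g D p =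
    trace (matrix_inv (\<chi> k l. lorentz_form (axis k 1) (axis l 1))
      ** (\<chi> k l. h (axis l 1) (axis k 1)))"
proof -
  define b where "b = (SOME b. frame_at A p b)"
  have b: "frame_at A p b"
    unfolding b_def by (rule someI[of _ e]) (rule frame_at_e)
  define B where "B = (\<chi> i k. frame_comp p (b k p) $ i)"
  define N where "N = gram_matrix e p"
  define H where "H = (\<chi> k l. h (axis l 1) (axis k 1))"
  have bVF: "b k \<in> VF" for k
    using b by (simp add: frame_at_def)
  have "basis_at A p (\<lambda>k. b k p)"
    using b by (simp add: frame_at_def)
  then have invB: "invertible B"
    unfolding B_def by (rule basis_matrix(1))
  note B = matrix_inv(1,2)[OF invB]
  have invN: "invertible N"
    by (simp add: invertible_det_nz N_def det_gram_matrix_e)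
  note N = matrix_inv(1,2)[OF invN]
  have col: "frame_comp p (b k p) = column k B" for k
    by (simp add: B_def column_def)
  have "bilinear (\<lambda>x y. h y x)"
    using h by (simp add: bilinear_def)
  note H = bilinear_matrix[OF this, of B, folded H_def]
  have "scalar_curvature A g D p =
      (\<Sum>i\<in>UNIV. \<Sum>j\<in>UNIV. matrix_inv (gram_matrix b p) $ i $ j * h (column i B) (column j B))"
    by (simp add: scalar_curvature_def Let_def model_ricci bVF col gram_matrix_def flip: b_def)
  also have "\<dots> = trace (matrix_inv (gram_matrix b p) ** (\<chi> k l. h (column l B) (column k B)))"
    by (simp add: trace_def matrix_matrix_mult_def)
  also have "matrix_inv (gram_matrix b p) = matrix_inv B ** matrix_inv N ** transpose (matrix_inv B)"
  proof (rule matrix_inv_unique)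
    have tr: "transpose B ** transpose (matrix_inv B) = mat 1"
      "transpose (matrix_inv B) ** transpose B = mat 1"
      using B by (metis matrix_transpose_mul transpose_mat)+
    have gm: "gram_matrix b p = transpose B ** N ** B"
      unfolding B_def N_def by (rule gram_matrix_frame[OF b])
    show "gram_matrix b p ** (matrix_inv B ** matrix_inv N ** transpose (matrix_inv B)) = mat 1"
      unfolding gm using B N tr by (metis matrix_mul_assoc matrix_mul_rid)
    show "matrix_inv B ** matrix_inv N ** transpose (matrix_inv B) ** gram_matrix b p = mat 1"
      unfolding gm using B N tr by (metis matrix_mul_assoc matrix_mul_rid)
  qed
  also have "trace (matrix_inv B ** matrix_inv N ** transpose (matrix_inv B)
      ** (\<chi> k l. h (column l B) (column k B))) = trace (matrix_inv N ** H)"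
  proof -
    have "transpose (matrix_inv B) ** transpose B = mat 1"
      using B by (metis matrix_transpose_mul transpose_mat)
    then have cancel: "transpose (matrix_inv B) ** (transpose B ** M) = M" for M :: "real^3^3"
      by (simp add: matrix_mul_assoc)
    have "matrix_inv B ** matrix_inv N ** transpose (matrix_inv B)
        ** (\<chi> k l. h (column l B) (column k B)) = matrix_inv B ** (matrix_inv N ** H ** B)"
      unfolding H by (simp add: cancel flip: matrix_mul_assoc)
    also have "trace \<dots> = trace (matrix_inv N ** H ** B ** matrix_inv B)"
      by (rule trace_mul_sym)
    also have "matrix_inv N ** H ** B ** matrix_inv B = matrix_inv N ** H"
      by (simp add: B flip: matrix_mul_assoc)
    finally show ?thesis .
  qed
  finally show ?thesis
    by (simp add: N_def H_def gram_matrix_e)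
qed

end

section \<open>Curvature of a connection with constant coefficients\<close>

text \<open>The tensors of a homogeneous metric, computed from the bilinear map \<open>\<Gamma>\<close> with
  \<open>\<nabla>\<^sub>x y = \<Gamma> x y\<close> on fields with constant components. The bracket of such fields is
  \<open>\<Gamma> x y - \<Gamma> y x\<close> because the torsion vanishes, and directional derivatives of tensor components
  are zero.\<close>

definition model_riemann :: "(real^3 \<Rightarrow> real^3 \<Rightarrow> real^3) \<Rightarrow> real^3 \<Rightarrow> real^3 \<Rightarrow> real^3 \<Rightarrow> real^3" where
  "model_riemann \<Gamma> x y z = \<Gamma> (\<Gamma> x y - \<Gamma> y x) z - (\<Gamma> x (\<Gamma> y z) - \<Gamma> y (\<Gamma> x z))"

definition model_ricci :: "(real^3 \<Rightarrow> real^3 \<Rightarrow> real^3) \<Rightarrow> real^3 \<Rightarrow> real^3 \<Rightarrow> real" where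
  "model_ricci \<Gamma> x y = (\<Sum>i\<in>UNIV. model_riemann \<Gamma> x (axis i 1) y $ i)"

definition model_scalar :: "(real^3 \<Rightarrow> real^3 \<Rightarrow> real^3) \<Rightarrow> real" where
  "model_scalar \<Gamma> = trace (matrix_inv (\<chi> k l. lorentz_form (axis k 1) (axis l 1)) **
    (\<chi> k l. model_ricci \<Gamma> (axis l 1) (axis k 1)))"

definition model_schouten :: "(real^3 \<Rightarrow> real^3 \<Rightarrow> real^3) \<Rightarrow> real^3 \<Rightarrow> real^3 \<Rightarrow> real" where
  "model_schouten \<Gamma> x y = model_ricci \<Gamma> x y - model_scalar \<Gamma> / 4 * lorentz_form x y"

definition model_cotton03 :: "(real^3 \<Rightarrow> real^3 \<Rightarrow> real^3) \<Rightarrow> real^3 \<Rightarrow> real^3 \<Rightarrow> real^3 \<Rightarrow> real" where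
  "model_cotton03 \<Gamma> x y z = - model_schouten \<Gamma> (\<Gamma> x y) z - model_schouten \<Gamma> y (\<Gamma> x z)
    + model_schouten \<Gamma> (\<Gamma> y x) z + model_schouten \<Gamma> x (\<Gamma> y z)"

text \<open>The coefficients of the Levi-Civita connection in the frame are constant, which is the
  infinitesimal form of left invariance; skewness of \<open>\<Gamma> x\<close> is compatibility with the metric.\<close>

locale invariant_connection = lorentz_frame A g e
  for A :: "'a::topological_space atlas" and g :: "'a metric" and e :: "3 \<Rightarrow> 'a vfield" +
  fixes D :: "'a connection" and \<Gamma> :: "real^3 \<Rightarrow> real^3 \<Rightarrow> real^3"
  assumes lc: "levi_civita A g D"
    and bilinear_\<Gamma>: "bilinear \<Gamma>"
    and skew_\<Gamma>: "\<And>x y z. lorentz_form (\<Gamma> x y) z = - lorentz_form y (\<Gamma> x z)"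
    and D_e: "\<And>p i j. frame_comp p (D (e i) (e j) p) = \<Gamma> (axis i 1) (axis j 1)"
begin

lemmas \<Gamma>_simps = bilinear_ladd[OF bilinear_\<Gamma>] bilinear_radd[OF bilinear_\<Gamma>]
  bilinear_lsub[OF bilinear_\<Gamma>] bilinear_rsub[OF bilinear_\<Gamma>]
  bilinear_lmul[OF bilinear_\<Gamma>] bilinear_rmul[OF bilinear_\<Gamma>]
  bilinear_lzero[OF bilinear_\<Gamma>] bilinear_rzero[OF bilinear_\<Gamma>]

lemma D_VF: "X \<in> VF \<Longrightarrow> Y \<in> VF \<Longrightarrow> D X Y \<in> VF"
  using lc by (simp add: levi_civita_def affine_connection_def)

lemma D_T: "X \<in> VF \<Longrightarrow> Y \<in> VF \<Longrightarrow> D X Y p \<in> T p"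
  by (rule VF_T[OF D_VF])

lemma D_tensorial:
  assumes "X \<in> VF"
  shows "frame_comp p (D X (e k) p) = \<Gamma> (frame_comp p (X p)) (axis k 1)"
proof -
  define x where "x i p = frame_comp p (X p) $ i" for i p
  have x: "x i \<in> smooth_functions A" for i
    using smooth_frame_comp[OF assms] unfolding x_def .
  have X: "X = vadd (vmult (x 1) (e 1)) (vadd (vmult (x 2) (e 2)) (vmult (x 3) (e 3)))"
  proof (intro ext)
    fix q f
    have "X q f = combination q (frame_comp q (X q)) f"
      by (simp add: combination_frame_comp VF_T[OF assms])
    then show "X q f = vadd (vmult (x 1) (e 1)) (vadd (vmult (x 2) (e 2)) (vmult (x 3) (e 3))) q f"
      by (simp add: combination_def sum_3 vadd_def vmult_def x_def)
  qed
  have aff: "affine_connection A D"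
    using lc by (simp add: levi_civita_def)
  have "D X (e k) = vadd (vmult (x 1) (D (e 1) (e k)))
      (vadd (vmult (x 2) (D (e 2) (e k))) (vmult (x 3) (D (e 3) (e k))))"
    by (subst X) (use aff in \<open>simp add: affine_connection_def e_VF x\<close>)
  then have "D X (e k) p = (\<lambda>f. \<Sum>i\<in>UNIV. x i p * D (e i) (e k) p f)"
    by (simp add: vadd_def vmult_def sum_3 add.assoc)
  then have "frame_comp p (D X (e k) p) = (\<Sum>i\<in>UNIV. x i p *\<^sub>R \<Gamma> (axis i 1) (axis k 1))"
    by (simp add: frame_comp_sum D_T e_VF D_e)
  also have "\<dots> = \<Gamma> (\<Sum>i\<in>UNIV. x i p *\<^sub>R axis i 1) (axis k 1)"
    by (simp add: sum_3 \<Gamma>_simps)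
  also have "(\<Sum>i\<in>UNIV. x i p *\<^sub>R axis i 1) = frame_comp p (X p)"
    by (simp add: x_def basis_expansion flip: scalar_mult_eq_scaleR)
  finally show ?thesis .
qed

text \<open>Pair with \<open>e\<^sub>k\<close> and use compatibility with the metric: \<open>g(D\<^sub>X Y, e\<^sub>k) = X g(Y, e\<^sub>k) - g(Y, D\<^sub>X e\<^sub>k)\<close>.
  The first term is the derivative of a component of \<open>Y\<close>, and the second is \<open>g(\<Gamma> x y, e\<^sub>k)\<close> by
  \<open>D_tensorial\<close> and skewness.\<close>

lemma D_frame_comp:
  assumes "X \<in> VF" "Y \<in> VF"
  shows "frame_comp p (D X Y p) = derivative (X p) (\<lambda>q. frame_comp q (Y q))
    + \<Gamma> (frame_comp p (X p)) (frame_comp p (Y p))"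
proof -
  define x where "x = frame_comp p (X p)"
  define y where "y q = frame_comp q (Y q)" for q
  have main: "lorentz_form (frame_comp p (D X Y p)) (axis k 1) =
      X p (\<lambda>q. g q (Y q) (e k q)) + lorentz_form (\<Gamma> x (y p)) (axis k 1)" for k
  proof -
    have "X p (inner_fields g Y (e k)) =
        inner_fields g (D X Y) (e k) p + inner_fields g Y (D X (e k)) p"
      using lc assms e_VF unfolding levi_civita_def by blast
    then have "X p (\<lambda>q. g q (Y q) (e k q)) =
        lorentz_form (frame_comp p (D X Y p)) (axis k 1) + lorentz_form (y p) (\<Gamma> x (axis k 1))"
      by (simp add: inner_fields_def metric_frame_comp D_T VF_T[OF assms(2)] e_T assms e_VF
          frame_comp_e D_tensorial x_def y_def)
    then show ?thesis
      by (simp add: skew_\<Gamma>)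
  qed
  have X: "X p \<in> T p"
    by (rule VF_T[OF assms(1)])
  have "derivative (X p) y = vector [X p (\<lambda>q. g q (Y q) (e 1 q)),
      - X p (\<lambda>q. g q (Y q) (e 3 q)), - X p (\<lambda>q. g q (Y q) (e 2 q))]"
    by (simp add: derivative_def y_def frame_comp_def vec_eq_iff forall_3
        tangent_uminus[OF X] metric_smooth assms e_VF)
  then show ?thesis
    using main[of 1] main[of 2] main[of 3]
    by (simp add: vec_eq_iff forall_3 lorentz_form_def axis_def x_def y_def[symmetric, abs_def])
qed

lemma bracket_D:
  "X \<in> VF \<Longrightarrow> Y \<in> VF \<Longrightarrow> bracket X Y = (\<lambda>p f. D X Y p f - D Y X p f)"
  using lc unfolding levi_civita_def by blast

lemma bracket_VF: "X \<in> VF \<Longrightarrow> Y \<in> VF \<Longrightarrow> bracket X Y \<in> VF"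
  by (simp add: bracket_D diff_VF D_VF)

lemma bracket_frame_comp:
  assumes "X \<in> VF" "Y \<in> VF"
  shows "frame_comp p (bracket X Y p) =
      derivative (X p) (\<lambda>q. frame_comp q (Y q)) - derivative (Y p) (\<lambda>q. frame_comp q (X q))
      + (\<Gamma> (frame_comp p (X p)) (frame_comp p (Y p)) - \<Gamma> (frame_comp p (Y p)) (frame_comp p (X p)))"
  by (simp add: bracket_D frame_comp_diff D_T D_frame_comp assms)

text \<open>Commuting second derivatives is the definition of the bracket of derivations; this is the
  identity that removes the second derivatives from the curvature.\<close>

lemma derivative_bracket:
  "derivative (bracket X Y p) z =
    derivative (X p) (\<lambda>q. derivative (Y q) z) - derivative (Y p) (\<lambda>q. derivative (X q) z)"
  by (simp add: derivative_def bracket_def vec_eq_iff)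

lemma smooth_derivative:
  assumes "X \<in> VF" "\<And>i. (\<lambda>q. z q $ i) \<in> smooth_functions A"
  shows "(\<lambda>q. derivative (X q) z $ i) \<in> smooth_functions A"
  using VF_smooth[OF assms] by (simp add: derivative_def)

lemma bilinear_\<Gamma>_component: "bilinear (\<lambda>x y. \<Gamma> x y $ i)"
  using bilinear_\<Gamma> unfolding bilinear_def linear_iff by simp

lemma smooth_\<Gamma>:
  assumes "\<And>i. (\<lambda>q. y q $ i) \<in> smooth_functions A" "\<And>i. (\<lambda>q. z q $ i) \<in> smooth_functions A"
  shows "(\<lambda>q. \<Gamma> (y q) (z q) $ i) \<in> smooth_functions A"
  by (rule smooth_bilinear[OF bilinear_\<Gamma>_component assms])

lemma derivative_\<Gamma>:
  assumes "v \<in> T p" "\<And>i. (\<lambda>q. y q $ i) \<in> smooth_functions A"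
    "\<And>i. (\<lambda>q. z q $ i) \<in> smooth_functions A"
  shows "derivative v (\<lambda>q. \<Gamma> (y q) (z q)) = \<Gamma> (derivative v y) (z p) + \<Gamma> (y p) (derivative v z)"
  using tangent_bilinear[OF bilinear_\<Gamma>_component assms]
  unfolding derivative_def[of v "\<lambda>q. \<Gamma> (y q) (z q)"] by (simp add: vec_eq_iff)

lemma D_D_frame_comp:
  assumes "X \<in> VF" "Y \<in> VF" "Z \<in> VF"
  defines "x \<equiv> \<lambda>q. frame_comp q (X q)" and "y \<equiv> \<lambda>q. frame_comp q (Y q)"
    and "z \<equiv> \<lambda>q. frame_comp q (Z q)"
  shows "frame_comp p (D X (D Y Z) p) =
    derivative (X p) (\<lambda>q. derivative (Y q) z)
    + \<Gamma> (derivative (X p) y) (z p) + \<Gamma> (y p) (derivative (X p) z)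
    + \<Gamma> (x p) (derivative (Y p) z) + \<Gamma> (x p) (\<Gamma> (y p) (z p))"
proof -
  have X: "X p \<in> T p" by (rule VF_T[OF assms(1)])
  have sm: "(\<lambda>q. y q $ i) \<in> smooth_functions A" "(\<lambda>q. z q $ i) \<in> smooth_functions A" for i
    unfolding y_def z_def using smooth_frame_comp assms(2,3) by blast+
  have "frame_comp p (D X (D Y Z) p) =
      derivative (X p) (\<lambda>q. derivative (Y q) z + \<Gamma> (y q) (z q))
      + \<Gamma> (x p) (derivative (Y p) z + \<Gamma> (y p) (z p))"
    by (simp add: D_frame_comp D_VF assms)
  also have "derivative (X p) (\<lambda>q. derivative (Y q) z + \<Gamma> (y q) (z q)) =
      derivative (X p) (\<lambda>q. derivative (Y q) z)
      + (\<Gamma> (derivative (X p) y) (z p) + \<Gamma> (y p) (derivative (X p) z))"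
    by (subst derivative_add[OF X smooth_derivative[OF assms(2) sm(2)] smooth_\<Gamma>[OF sm]])
      (simp add: derivative_\<Gamma>[OF X sm])
  finally show ?thesis
    by (simp add: \<Gamma>_simps)
qed

lemma curv_T:
  assumes "X \<in> VF" "Y \<in> VF" "Z \<in> VF"
  shows "curv D X Y Z p \<in> T p"
  unfolding curv_def using assms by (intro diff_in_T) (simp_all add: D_T D_VF bracket_VF)

text \<open>All terms of \<open>D_D_frame_comp\<close> that contain a derivative cancel against those of
  \<open>D (bracket X Y) Z\<close>, which leaves the curvature of fields with constant components.\<close>

lemma curv_frame_comp:
  assumes "X \<in> VF" "Y \<in> VF" "Z \<in> VF"
  shows "frame_comp p (curv D X Y Z p) =
    model_riemann \<Gamma> (frame_comp p (X p)) (frame_comp p (Y p)) (frame_comp p (Z p))"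
proof -
  have "frame_comp p (curv D X Y Z p) = frame_comp p (D (bracket X Y) Z p)
      - (frame_comp p (D X (D Y Z) p) - frame_comp p (D Y (D X Z) p))"
    using assms unfolding curv_def
    by (simp add: frame_comp_diff diff_in_T D_T D_VF bracket_VF)
  then show ?thesis
    using assms
    by (simp add: D_D_frame_comp D_frame_comp[OF bracket_VF] derivative_bracket
        bracket_frame_comp model_riemann_def \<Gamma>_simps)
qed

lemma linear_model_riemann:
  "linear (\<lambda>x. model_riemann \<Gamma> x y z)"
  "linear (\<lambda>y. model_riemann \<Gamma> x y z)"
  "linear (\<lambda>z. model_riemann \<Gamma> x y z)"
  by (auto intro!: linearI simp: model_riemann_def \<Gamma>_simps algebra_simps)

lemma bilinear_model_ricci: "bilinear (model_ricci \<Gamma>)"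
  unfolding bilinear_def model_ricci_def
  by (auto intro!: linearI
      simp: linear_add[OF linear_model_riemann(1)] linear_add[OF linear_model_riemann(3)]
      linear_cmul[OF linear_model_riemann(1)] linear_cmul[OF linear_model_riemann(3)]
      sum.distrib sum_distrib_left)

lemma ricci_eq:
  assumes "X \<in> VF" "Y \<in> VF"
  shows "ricci A D X Y p = model_ricci \<Gamma> (frame_comp p (X p)) (frame_comp p (Y p))"
proof -
  define M where "M = matrix (\<lambda>z. model_riemann \<Gamma> (frame_comp p (X p)) z (frame_comp p (Y p)))"
  have "ricci A D X Y p = trace M"
    unfolding ricci_def
  proof (rule trace_at_eq)
    fix Z assume Z: "Z \<in> VF"
    show "curv D X Z Y p \<in> T p"
      using assms Z by (intro curv_T)
    show "frame_comp p (curv D X Z Y p) = M *v frame_comp p (Z p)"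
      using fun_cong[OF matrix_vector_mul(2)[OF linear_model_riemann(2)]] assms Z
      by (simp add: curv_frame_comp M_def)
  qed
  then show ?thesis
    by (simp add: trace_def M_def matrix_def model_ricci_def)
qed

lemma scalar_curvature_const: "scalar_curvature A g D p = model_scalar \<Gamma>"
  unfolding model_scalar_def by (rule scalar_curvature_eq[OF bilinear_model_ricci ricci_eq])

lemma schouten_eq:
  assumes "X \<in> VF" "Y \<in> VF"
  shows "schouten A g D X Y p = model_schouten \<Gamma> (frame_comp p (X p)) (frame_comp p (Y p))"
  using assms
  by (simp add: schouten_def model_schouten_def ricci_eq scalar_curvature_const inner_fields_def
      metric_frame_comp VF_T)

lemma bilinear_model_schouten: "bilinear (model_schouten \<Gamma>)"
  using bilinear_model_ricci bilinear_lorentz_form unfolding bilinear_def linear_iff model_schouten_def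
  by (simp add: algebra_simps)

text \<open>By the Leibniz rule the derivatives of the components of \<open>Y\<close> and \<open>Z\<close> that come from
  \<open>X p (schouten A g D Y Z)\<close> cancel against those in \<open>D X Y\<close> and \<open>D X Z\<close>. The Schouten tensor itself
  has constant components, so it contributes none.\<close>

lemma cov_deriv2_schouten:
  assumes "X \<in> VF" "Y \<in> VF" "Z \<in> VF"
  shows "cov_deriv2 D (schouten A g D) X Y Z p =
    - model_schouten \<Gamma> (\<Gamma> (frame_comp p (X p)) (frame_comp p (Y p))) (frame_comp p (Z p))
    - model_schouten \<Gamma> (frame_comp p (Y p)) (\<Gamma> (frame_comp p (X p)) (frame_comp p (Z p)))"
proof -
  have "X p (schouten A g D Y Z) =
      X p (\<lambda>q. model_schouten \<Gamma> (frame_comp q (Y q)) (frame_comp q (Z q)))"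
    by (rule arg_cong[of _ _ "X p"]) (simp add: fun_eq_iff schouten_eq assms)
  also have "\<dots> = model_schouten \<Gamma> (derivative (X p) (\<lambda>q. frame_comp q (Y q))) (frame_comp p (Z p))
      + model_schouten \<Gamma> (frame_comp p (Y p)) (derivative (X p) (\<lambda>q. frame_comp q (Z q)))"
    by (rule tangent_bilinear[OF bilinear_model_schouten VF_T[OF assms(1)]
          smooth_frame_comp[OF assms(2)] smooth_frame_comp[OF assms(3)]])
  finally show ?thesis
    by (simp add: cov_deriv2_def schouten_eq D_VF D_frame_comp assms
        bilinear_ladd[OF bilinear_model_schouten] bilinear_radd[OF bilinear_model_schouten])
qed

lemma cotton03_eq:
  assumes "X \<in> VF" "Y \<in> VF" "Z \<in> VF"
  shows "cotton03 A g D X Y Z p =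
    model_cotton03 \<Gamma> (frame_comp p (X p)) (frame_comp p (Y p)) (frame_comp p (Z p))"
  using assms by (simp add: cotton03_def cov_deriv2_schouten model_cotton03_def)

end

section \<open>The Cotton tensor of type (0,2)\<close>

definition model_cotton02 :: "(real^3 \<Rightarrow> real^3 \<Rightarrow> real^3) \<Rightarrow> real^3 \<Rightarrow> real^3 \<Rightarrow> real" where
  "model_cotton02 \<Gamma> u v = (\<Sum>n\<in>UNIV. \<Sum>m\<in>UNIV. \<Sum>k\<in>UNIV.
    model_cotton03 \<Gamma> (axis n 1) (axis m 1) u * levi_civita_symbol n m k
      * lorentz_form (axis k 1) v) / 2"

text \<open>Contraction with the Levi-Civita symbol sees only the totally antisymmetric part of the
  trilinear form \<open>C x y * l z\<close>, and on that part a matrix acts by its determinant.\<close>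

lemma alternating_sum_det:
  fixes C :: "real^3 \<Rightarrow> real^3 \<Rightarrow> real" and l :: "real^3 \<Rightarrow> real"
  assumes "bilinear C" and "linear l"
  shows "(\<Sum>n\<in>UNIV. \<Sum>m\<in>UNIV. \<Sum>k\<in>UNIV.
      C (column n B) (column m B) * levi_civita_symbol n m k * l (column k B)) =
    det B * (\<Sum>n\<in>UNIV. \<Sum>m\<in>UNIV. \<Sum>k\<in>UNIV.
      C (axis n 1) (axis m 1) * levi_civita_symbol n m k * l (axis k 1))"
proof -
  define c where "c i j = C (axis i 1) (axis j 1)" for i j
  have C: "C (column n B) (column m B) = (\<Sum>i\<in>UNIV. \<Sum>j\<in>UNIV. B$i$n * B$j$m * c i j)" for n m
    by (subst bilinear_expand[OF assms(1)]) (simp add: column_def c_def)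
  have l: "l (column k B) = (\<Sum>i\<in>UNIV. B$i$k * l (axis i 1))" for k
  proof -
    have "l (column k B) = l (\<Sum>i\<in>UNIV. B$i$k *\<^sub>R axis i 1)"
      using basis_expansion[of "column k B"]
      by (simp add: column_def flip: scalar_mult_eq_scaleR)
    then show ?thesis
      using assms(2) by (simp add: linear_sum linear_cmul)
  qed
  show ?thesis
    unfolding C l c_def[symmetric]
    by (simp add: sum_3 levi_civita_symbol_def det_3) (simp add: algebra_simps)
qed

context invariant_connection
begin

lemmas model_schouten_simps =
  bilinear_ladd[OF bilinear_model_schouten] bilinear_radd[OF bilinear_model_schouten]
  bilinear_lmul[OF bilinear_model_schouten] bilinear_rmul[OF bilinear_model_schouten]

lemma bilinear_model_cotton03: "bilinear (\<lambda>x y. model_cotton03 \<Gamma> x y z)"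
  unfolding bilinear_def linear_iff
  by (simp add: model_cotton03_def \<Gamma>_simps model_schouten_simps algebra_simps)

lemma linear_model_cotton03: "linear (model_cotton03 \<Gamma> x y)"
  unfolding linear_iff
  by (simp add: model_cotton03_def \<Gamma>_simps model_schouten_simps algebra_simps)

lemma bilinear_model_cotton02: "bilinear (model_cotton02 \<Gamma>)"
proof -
  have "linear (model_cotton02 \<Gamma> u)" for u
    unfolding linear_iff
    by (simp add: model_cotton02_def bilinear_radd[OF bilinear_lorentz_form]
        bilinear_rmul[OF bilinear_lorentz_form]
        sum_3 algebra_simps add_divide_distrib)
  moreover have "linear (\<lambda>u. model_cotton02 \<Gamma> u v)" for v
    unfolding linear_iff
    by (simp add: model_cotton02_def linear_add[OF linear_model_cotton03]
        linear_cmul[OF linear_model_cotton03]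
        sum_3 algebra_simps add_divide_distrib)
  ultimately show ?thesis
    by (simp add: bilinear_def)
qed

text \<open>A change of frame with matrix \<open>B\<close> multiplies the antisymmetrised sum by \<open>det B\<close> and the
  factor \<open>1 / sqrt \<bar>det g\<bar>\<close> by \<open>1 / \<bar>det B\<bar>\<close>. So \<open>\<kappa>\<close> is the sign of \<open>det B\<close>, which
  tells whether the frame \<open>e\<close> is positively oriented at \<open>p\<close>.\<close>

lemma cotton02_eq:
  assumes "orientation A Or"
  obtains \<kappa> where "\<kappa> \<noteq> 0"
    and "\<And>u v. u \<in> T p \<Longrightarrow> v \<in> T p \<Longrightarrow>
      cotton02 A g D Or p u v = \<kappa> * model_cotton02 \<Gamma> (frame_comp p u) (frame_comp p v)"
proof -
  define b where "b = (SOME b. frame_at A p b \<and> (\<lambda>k. b k p) \<in> Or p)"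
  obtain U E where "p \<in> U" "\<forall>i. E i \<in> VF" "\<forall>q\<in>U. (\<lambda>i. E i q) \<in> Or q"
    using assms unfolding orientation_def by blast
  moreover have "\<forall>b\<in>Or p. basis_at A p b"
    using assms unfolding orientation_def by blast
  ultimately have "frame_at A p E \<and> (\<lambda>k. E k p) \<in> Or p"
    by (auto simp: frame_at_def)
  then have "frame_at A p b \<and> (\<lambda>k. b k p) \<in> Or p"
    unfolding b_def by (rule someI[of "\<lambda>b. frame_at A p b \<and> (\<lambda>k. b k p) \<in> Or p"])
  then have b: "frame_at A p b"
    by simp
  define B where "B = (\<chi> i k. frame_comp p (b k p) $ i)"
  have bVF: "b k \<in> VF" for k
    using b by (simp add: frame_at_def)
  have "basis_at A p (\<lambda>k. b k p)"
    using b by (simp add: frame_at_def)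
  note B = basis_matrix[OF this, folded B_def]
  have col: "frame_comp p (b k p) = column k B" for k
    by (simp add: B_def column_def)
  define s where "s = sqrt \<bar>det (gram_matrix b p)\<bar>"
  have detB: "det B \<noteq> 0"
    using B(1) by (simp add: invertible_det_nz)
  have "gram_matrix b p = transpose B ** gram_matrix e p ** B"
    unfolding B_def by (rule gram_matrix_frame[OF b])
  then have s: "s \<noteq> 0"
    using detB by (simp add: s_def det_mul det_transpose det_gram_matrix_e)
  have comp: "cotton02_component A g D b p i j =
      det B / s * model_cotton02 \<Gamma> (column i B) (column j B)" for i j
  proof -
    have lin: "linear (\<lambda>z. lorentz_form z (column j B))"
      using bilinear_lorentz_form by (simp add: bilinear_def)
    have "cotton02_component A g D b p i j = 1 / (2 * s) * (\<Sum>n\<in>UNIV. \<Sum>m\<in>UNIV. \<Sum>k\<in>UNIV.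
        model_cotton03 \<Gamma> (column n B) (column m B) (column i B) * levi_civita_symbol n m k
          * lorentz_form (column k B) (column j B))"
      by (simp add: cotton02_component_def cotton03_eq bVF col inner_fields_def
          metric_frame_comp VF_T s_def gram_matrix_def)
    then show ?thesis
      unfolding alternating_sum_det[OF bilinear_model_cotton03 lin] model_cotton02_def by simp
  qed
  show ?thesis
  proof (rule that[of "det B / s"])
    show "det B / s \<noteq> 0"
      using detB s by simp
    fix u v assume u: "u \<in> T p" and v: "v \<in> T p"
    define c where "c = coords (\<lambda>k. b k p) u"
    define d where "d = coords (\<lambda>k. b k p) v"
    have "cotton02 A g D Or p u v =
        (\<Sum>i\<in>UNIV. \<Sum>j\<in>UNIV. c$i * d$j *
          (det B / s * model_cotton02 \<Gamma> (column i B) (column j B)))"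
      by (simp add: cotton02_def Let_def comp c_def d_def flip: b_def)
    also have "\<dots> = det B / s *
        model_cotton02 \<Gamma> (\<Sum>i\<in>UNIV. c$i *\<^sub>R column i B) (\<Sum>j\<in>UNIV. d$j *\<^sub>R column j B)"
      by (simp add: bilinear_sum[OF bilinear_model_cotton02] bilinear_lmul[OF bilinear_model_cotton02]
          bilinear_rmul[OF bilinear_model_cotton02] sum.cartesian_product
          sum_distrib_left split_def mult_ac)
    also have "(\<Sum>i\<in>UNIV. c$i *\<^sub>R column i B) = frame_comp p u"
      using B(2)[OF u] by (simp add: c_def matrix_mult_sum scalar_mult_eq_scaleR)
    also have "(\<Sum>i\<in>UNIV. d$i *\<^sub>R column i B) = frame_comp p v"
      using B(2)[OF v] by (simp add: d_def matrix_mult_sum scalar_mult_eq_scaleR)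
    finally show "cotton02 A g D Or p u v =
        det B / s * model_cotton02 \<Gamma> (frame_comp p u) (frame_comp p v)" .
  qed
qed

text \<open>With constant components the derivative terms in the Lie derivative vanish and only the
  structure constants remain, in the form \<open>[x, y] = \<Gamma> x y - \<Gamma> y x\<close>.\<close>

lemma lie_derivative_metric_eq:
  assumes X: "X \<in> VF" and c: "\<And>q. frame_comp q (X q) = c"
  shows "lie_derivative_metric g X (e i) (e j) p =
    - lorentz_form (\<Gamma> c (axis i 1) - \<Gamma> (axis i 1) c) (axis j 1)
    - lorentz_form (axis i 1) (\<Gamma> c (axis j 1) - \<Gamma> (axis j 1) c)"
proof -
  have "X p (inner_fields g (e i) (e j)) = 0"
    by (simp add: inner_fields_def gram tangent_const[OF VF_T[OF X]])
  moreover have "frame_comp p (bracket X (e k) p) = \<Gamma> c (axis k 1) - \<Gamma> (axis k 1) c" for k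
    by (simp add: bracket_frame_comp X e_VF c frame_comp_e
        derivative_const[OF VF_T[OF X]] derivative_const[OF e_T])
  ultimately show ?thesis
    by (simp add: lie_derivative_metric_def inner_fields_def metric_frame_comp VF_T X e_VF
        bracket_VF frame_comp_e)
qed

end

section \<open>Type IV.3\<close>

text \<open>The Levi-Civita connection of the Lie algebra, obtained from the Koszul formula
  \<open>2 g(\<nabla>\<^sub>x y, z) = g([x,y],z) - g([y,z],x) + g([z,x],y)\<close>.\<close>

definition nabla_IV3 :: "real \<Rightarrow> real \<Rightarrow> real \<Rightarrow> real \<Rightarrow> real^3 \<Rightarrow> real^3 \<Rightarrow> real^3" where
  "nabla_IV3 \<alpha> \<beta> \<gamma> \<delta> x y = vector
    [\<alpha> * x$1 * y$3 + \<gamma>/2 * (x$2 * y$3 - x$3 * y$2) - \<beta> * x$3 * y$3,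
     \<alpha> * x$1 * y$1 + \<gamma>/2 * (x$1 * y$2 + x$2 * y$1) - \<beta> * x$3 * y$1 - \<delta> * x$3 * y$2,
     \<delta> * x$3 * y$3 - \<gamma>/2 * (x$1 * y$3 + x$3 * y$1)]"

lemma bilinear_nabla_IV3: "bilinear (nabla_IV3 \<alpha> \<beta> \<gamma> \<delta>)"
  unfolding bilinear_def linear_iff by (simp add: nabla_IV3_def vec_eq_iff forall_3 algebra_simps)

lemma skew_nabla_IV3:
  "lorentz_form (nabla_IV3 \<alpha> \<beta> \<gamma> \<delta> x y) z = - lorentz_form y (nabla_IV3 \<alpha> \<beta> \<gamma> \<delta> x z)"
  by (simp add: lorentz_form_def nabla_IV3_def algebra_simps)

text \<open>The Ricci tensor is brought to closed form first, so that the Cotton tensor below becomes a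
  computation with first covariant derivatives of an explicit bilinear form.\<close>

lemma model_ricci_nabla_IV3:
  "model_ricci (nabla_IV3 \<alpha> \<beta> \<gamma> \<delta>) x y =
    - (\<gamma>^2/2) * (x$1 * y$1 + x$2 * y$3 + x$3 * y$2)
    - \<alpha> * \<gamma> * (x$1 * y$3 + x$3 * y$1) + (\<alpha> * \<delta> - \<alpha>^2 - \<beta> * \<gamma>) * x$3 * y$3"
  by (simp add: model_ricci_def model_riemann_def nabla_IV3_def axis_def sum_3 lorentz_form_def)
    (simp add: field_simps power2_eq_square)

text \<open>The scalar curvature enters only through a constant multiple of the metric, which is parallel,
  so it drops out of the result. Each coefficient carries a factor \<open>\<gamma>\<close>.\<close>

lemma model_cotton02_nabla_IV3:
  "model_cotton02 (nabla_IV3 \<alpha> \<beta> \<gamma> \<delta>) u v =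
    \<gamma>^3 * (u$1 * v$1 + (u$2 * v$3 + u$3 * v$2) / 2)
    + 3/2 * \<alpha> * \<gamma>^2 * (u$1 * v$3 + u$3 * v$1)
    + (3 * \<alpha>^2 - \<alpha> * \<delta> + \<beta> * \<gamma>) * \<gamma> / 2 * (u$3 * v$3)"
  by (simp add: model_cotton02_def model_cotton03_def model_schouten_def
      model_ricci_nabla_IV3 sum_3 levi_civita_symbol_def)
    (simp add: nabla_IV3_def axis_def lorentz_form_def field_simps power2_eq_square power3_eq_cube)

locale type_IV_3 = lorentz_frame A g e
  for A :: "'a::topological_space atlas" and g :: "'a metric" and e :: "3 \<Rightarrow> 'a vfield" +
  fixes D :: "'a connection" and \<alpha> \<beta> \<gamma> \<delta> :: real
  assumes lc: "levi_civita A g D"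
    and bracket12: "bracket (e 1) (e 2) = (\<lambda>p f. 0)"
    and bracket13: "bracket (e 1) (e 3) = vadd (vmult (\<lambda>p. \<alpha>) (e 1)) (vmult (\<lambda>p. \<beta>) (e 2))"
    and bracket23: "bracket (e 2) (e 3) = vadd (vmult (\<lambda>p. \<gamma>) (e 1)) (vmult (\<lambda>p. \<delta>) (e 2))"
begin

text \<open>The numbers \<open>g(D\<^sub>i e\<^sub>j, e\<^sub>k)\<close> are the unique solution of the linear system formed by
  compatibility with the metric (skewness in \<open>j\<close>, \<open>k\<close>) and vanishing torsion (the part
  antisymmetric in \<open>i\<close>, \<open>j\<close> is given by the brackets).\<close>

lemma koszul: "frame_comp p (D (e i) (e j) p) = nabla_IV3 \<alpha> \<beta> \<gamma> \<delta> (axis i 1) (axis j 1)"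
proof -
  have DT: "D (e i) (e j) p \<in> T p" for i j
    using lc e_VF VF_T unfolding levi_civita_def affine_connection_def by blast
  define G where "G i j k = g p (D (e i) (e j) p) (e k p)" for i j k
  have compat: "G i j k + G i k j = 0" for i j k
  proof -
    have "e i p (inner_fields g (e j) (e k)) =
        inner_fields g (D (e i) (e j)) (e k) p + inner_fields g (e j) (D (e i) (e k)) p"
      using lc e_VF unfolding levi_civita_def by blast
    moreover have "e i p (inner_fields g (e j) (e k)) = 0"
      by (simp add: inner_fields_def gram tangent_const[OF e_T])
    ultimately show ?thesis
      by (simp add: inner_fields_def G_def metric_sym[OF e_T DT])
  qed
  have torsion: "G i j k - G j i k = g p (bracket (e i) (e j) p) (e k p)" for i j k
  proof -
    have "bracket (e i) (e j) p = (\<lambda>f. 1 * D (e i) (e j) p f + (-1) * D (e j) (e i) p f)"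
      using lc e_VF unfolding levi_civita_def by simp
    then show ?thesis
      using metric_lincomb[OF DT[of i j] DT[of j i] e_T[of k p], of 1 "-1"] unfolding G_def by simp
  qed
  have "g p (bracket (e 1) (e 2) p) (e k p) = 0" for k
    using metric_lincomb[OF zero_in_T zero_in_T e_T, of p 0 0 k] by (simp add: bracket12)
  moreover have "g p (bracket (e 1) (e 3) p) (e k p) =
      \<alpha> * lorentz_form (axis 1 1) (axis k 1) + \<beta> * lorentz_form (axis 2 1) (axis k 1)" for k
    using metric_lincomb[OF e_T e_T e_T] by (simp add: bracket13 vadd_def vmult_def gram)
  moreover have "g p (bracket (e 2) (e 3) p) (e k p) =
      \<gamma> * lorentz_form (axis 1 1) (axis k 1) + \<delta> * lorentz_form (axis 2 1) (axis k 1)" for k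
    using metric_lincomb[OF e_T e_T e_T] by (simp add: bracket23 vadd_def vmult_def gram)
  ultimately have tors:
    "\<forall>k. G 1 2 k - G 2 1 k = 0"
    "\<forall>k. G 1 3 k - G 3 1 k =
      \<alpha> * lorentz_form (axis 1 1) (axis k 1) + \<beta> * lorentz_form (axis 2 1) (axis k 1)"
    "\<forall>k. G 2 3 k - G 3 2 k =
      \<gamma> * lorentz_form (axis 1 1) (axis k 1) + \<delta> * lorentz_form (axis 2 1) (axis k 1)"
    by (simp_all add: torsion)
  have "\<forall>i j. frame_comp p (D (e i) (e j) p) = nabla_IV3 \<alpha> \<beta> \<gamma> \<delta> (axis i 1) (axis j 1)"
    using compat[of 1 1 1] compat[of 1 2 2] compat[of 1 3 3] compat[of 1 1 2] compat[of 1 1 3]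
      compat[of 1 2 3] compat[of 2 1 1] compat[of 2 2 2] compat[of 2 3 3] compat[of 2 1 2]
      compat[of 2 1 3] compat[of 2 2 3] compat[of 3 1 1] compat[of 3 2 2] compat[of 3 3 3]
      compat[of 3 1 2] compat[of 3 1 3] compat[of 3 2 3] tors
    unfolding forall_3 frame_comp_def G_def[symmetric]
    by (simp add: vec_eq_iff forall_3 nabla_IV3_def axis_def lorentz_form_def)
  then show ?thesis by blast
qed

sublocale invariant_connection A g e D "nabla_IV3 \<alpha> \<beta> \<gamma> \<delta>"
  by unfold_locales (rule lc bilinear_nabla_IV3 skew_nabla_IV3 koszul)+

end

theorem theorem11:
  fixes G :: "'a::{t2_space, second_countable_topology} monoid"
    and A :: "'a atlas"
    and g :: "'a metric"
    and D :: "'a connection"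
    and Or :: "'a \<Rightarrow> (3 \<Rightarrow> 'a tangent) set"
    and e :: "3 \<Rightarrow> 'a vfield"
    and \<alpha> \<beta> \<gamma> \<delta> :: real
  assumes "lie_group G A"
    and "connected (UNIV :: 'a set)"
    and "simply_connected (UNIV :: 'a set)"
    and "lorentzian A g"
    and "left_invariant_metric G A g"
    and "levi_civita A g D"
    and "orientation A Or"
    and "lie_algebra_basis G A e"
    and "inner_fields g (e 1) (e 1) = (\<lambda>p. 1)"
    and "inner_fields g (e 1) (e 2) = (\<lambda>p. 0)"
    and "inner_fields g (e 1) (e 3) = (\<lambda>p. 0)"
    and "inner_fields g (e 2) (e 2) = (\<lambda>p. 0)"
    and "inner_fields g (e 2) (e 3) = (\<lambda>p. -1)"
    and "inner_fields g (e 3) (e 3) = (\<lambda>p. 0)"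
    and "bracket (e 1) (e 2) = (\<lambda>p f. 0)"
    and "bracket (e 1) (e 3) = vadd (vmult (\<lambda>p. \<alpha>) (e 1)) (vmult (\<lambda>p. \<beta>) (e 2))"
    and "bracket (e 2) (e 3) = vadd (vmult (\<lambda>p. \<gamma>) (e 1)) (vmult (\<lambda>p. \<delta>) (e 2))"
    and "\<alpha> + \<delta> \<noteq> 0"
    and "\<alpha> * \<gamma> = 0"
    and "\<exists>X\<in>left_invariant_fields G A. \<exists>\<mu>. cotton_soliton A g D Or X \<mu>"
  shows "cotton_flat A g D Or"
proof -
  have atlas: "smooth_atlas A"
    using assms(1) by (simp add: lie_group_def)
  have e_inv: "e i \<in> left_invariant_fields G A" for i
    using assms(8) by (simp add: lie_algebra_basis_def)
  have e_VF: "e i \<in> vector_fields A" for i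
    using e_inv by (simp add: left_invariant_fields_def)
  have sym: "g p (e i p) (e j p) = g p (e j p) (e i p)" for p i j
    using assms(4) e_VF[of i] e_VF[of j]
    by (simp add: lorentzian_def pseudo_riemannian_def vector_fields_def)
  have gram: "g p (e i p) (e j p) = lorentz_form (axis i 1) (axis j 1)" for p i j
  proof -
    have "\<forall>i j. g p (e i p) (e j p) = lorentz_form (axis i 1) (axis j 1)"
      using assms(9-14)[THEN fun_cong, of p] sym[of p 2 1] sym[of p 3 1] sym[of p 3 2]
      unfolding forall_3 inner_fields_def by (simp add: lorentz_form_def axis_def)
    then show ?thesis by blast
  qed
  interpret type_IV_3 A g e D \<alpha> \<beta> \<gamma> \<delta>
    by (unfold_locales; fact atlas assms e_VF gram)
  show ?thesis
  proof (cases "\<gamma> = 0")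
    case True
    show ?thesis
      unfolding cotton_flat_def
    proof (intro allI ballI)
      fix p u v assume "u \<in> T p" "v \<in> T p"
      moreover obtain \<kappa> where "\<And>u v. u \<in> T p \<Longrightarrow> v \<in> T p \<Longrightarrow>
          cotton02 A g D Or p u v =
          \<kappa> * model_cotton02 (nabla_IV3 \<alpha> \<beta> \<gamma> \<delta>) (frame_comp p u) (frame_comp p v)"
        using cotton02_eq[OF assms(7), of p] by blast
      ultimately show "cotton02 A g D Or p u v = 0"
        by (simp add: model_cotton02_nabla_IV3 True)
    qed
  next
    case False
    then have "\<alpha> = 0"
      using assms(19) by simp
    obtain X \<mu> where X: "X \<in> left_invariant_fields G A" and sol: "cotton_soliton A g D Or X \<mu>"
      using assms(20) by blast
    obtain c :: "real^3" where c: "X = (\<lambda>p f. \<Sum>i\<in>UNIV. c$i * e i p f)"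
      using assms(8) X unfolding lie_algebra_basis_def by blast
    have XVF: "X \<in> VF"
      using X by (simp add: left_invariant_fields_def)
    have X_comp: "frame_comp q (X q) = c" for q
      using frame_comp_combination[of q c] by (simp add: c combination_def)
    \<comment> \<open>The soliton equation at any one point is enough; the identity element is a choice of one.\<close>
    define p where "p = \<one>\<^bsub>G\<^esub>"
    obtain \<kappa> where "\<kappa> \<noteq> 0" and \<kappa>: "\<And>u v. u \<in> T p \<Longrightarrow> v \<in> T p \<Longrightarrow>
        cotton02 A g D Or p u v =
          \<kappa> * model_cotton02 (nabla_IV3 \<alpha> \<beta> \<gamma> \<delta>) (frame_comp p u) (frame_comp p v)"
      using cotton02_eq[OF assms(7), of p] by blast
    have eq: "lie_derivative_metric g X (e i) (e j) p
        + \<kappa> * model_cotton02 (nabla_IV3 \<alpha> \<beta> \<gamma> \<delta>) (axis i 1) (axis j 1) =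
        \<mu> * lorentz_form (axis i 1) (axis j 1)" for i j
    proof -
      have "lie_derivative_metric g X (e i) (e j) p + cotton02 A g D Or p (e i p) (e j p)
          = \<mu> * inner_fields g (e i) (e j) p"
        using sol e_VF unfolding cotton_soliton_def by blast
      then show ?thesis
        by (simp add: \<kappa> e_T frame_comp_e inner_fields_def gram)
    qed
    note lie = lie_derivative_metric_eq[OF XVF X_comp]
    have "\<kappa> * \<gamma>^3 = \<mu>"
      using eq[of 1 1] by (simp add: lie model_cotton02_nabla_IV3 nabla_IV3_def lorentz_form_def axis_def
          \<open>\<alpha> = 0\<close>)
    moreover have "\<gamma> * c$3 = 0"
      using eq[of 1 2] by (simp add: lie model_cotton02_nabla_IV3 nabla_IV3_def lorentz_form_def axis_def
          \<open>\<alpha> = 0\<close>)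
    moreover have "\<kappa> * \<gamma>^3 / 2 - \<delta> * c$3 = - \<mu>"
      using eq[of 2 3] by (simp add: lie model_cotton02_nabla_IV3 nabla_IV3_def lorentz_form_def axis_def
          \<open>\<alpha> = 0\<close>)
    ultimately have "\<kappa> * \<gamma>^3 = 0"
      using False by simp
    with False \<open>\<kappa> \<noteq> 0\<close> have False
      by simp
    then show ?thesis ..
  qed
qed

end
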